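(* Let $G$ be a finite centreless group that is generated by a conjugacy class $Q$, regarded as a rack with $x\ast y=y^{-1}xy$. Let $\mathbb{A}=\mathbb{Q}[[h]]$ with ideal $\mathfrak{m}=(h)$, and let $c_Q\colon\mathbb{A}Q\otimes\mathbb{A}Q\to\mathbb{A}Q\otimes\mathbb{A}Q$, $x\otimes y\mapsto y\otimes(x\ast y)$. Then every Yang-Baxter deformation of $c_Q$ over $\mathbb{Q}[[h]]$ is equivalent to $s\cdot c_Q$ with some constant factor $s\in1+(h)$. In other words, $c_Q$ is rigid.
   Context: $\mathbb{A}Q$ is the free $\mathbb{A}$-module with basis $Q$; tensor products are over $\mathbb{A}$; $\mathrm{I}$ denotes the identity of $V=\mathbb{A}Q$. A Yang-Baxter operator on $V$ is an automorphism $c$ of $V\otimes V$ satisfying $(c\otimes\mathrm{I})(\mathrm{I}\otimes c)(c\otimes\mathrm{I})=(\mathrm{I}\otimes c)(c\otimes\mathrm{I})(\mathrm{I}\otimes c)$. A Yang-Baxter deformation of $c$ with respect to $\mathfrak{m}$ is a Yang-Baxter operator $\tilde c$ on $V$ with $\tilde c\equiv c$ modulo $\mathfrak{m}$. Two Yang-Baxter operators $c,\tilde c$ are equivalent (with respect to $\mathfrak{m}$) if there is an automorphism $\alpha\colon V\to V$ with $\alpha\equiv\mathrm{I}$ modulo $\mathfrak{m}$ and $\tilde c=(\alpha\otimes\alpha)\,c\,(\alpha\otimes\alpha)^{-1}$. A deformation of $c$ is trivial if it is equivalent to $c$ or to a rescaling $s\cdot c$ with $s\in1+\mathfrak{m}$;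 $c$ is rigid if every Yang-Baxter deformation of $c$ is trivial. *)

theory Defs
  imports
    "HOL-Library.Poly_Mapping"
    "HOL-Computational_Algebra.Formal_Power_Series"
    "HOL-Algebra.Generated_Groups"
begin

section \<open>Free modules and their tensor products\<close>

definition fscale :: "'r::comm_ring_1 \<Rightarrow> ('b \<Rightarrow>\<^sub>0 'r) \<Rightarrow> ('b \<Rightarrow>\<^sub>0 'r)" (infixr \<open>\<cdot>\<^sub>f\<close> 75)
  where "a \<cdot>\<^sub>f u = Poly_Mapping.map ((*) a) u"

lemma lookup_fscale [simp]: "Poly_Mapping.lookup (a \<cdot>\<^sub>f u) b = a * Poly_Mapping.lookup u b"
  unfolding fscale_def by transfer (auto simp: when_def)

interpretation fmod: module "fscale :: 'r::comm_ring_1 \<Rightarrow> ('b \<Rightarrow>\<^sub>0 'r) \<Rightarrow> _"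
  by standard (auto intro!: poly_mapping_eqI simp: lookup_add algebra_simps)

text \<open>The free module with basis \<open>B\<close>. The ring of scalars is the type \<open>'r\<close>; the basis vector
  of \<open>b\<close> is \<open>basis b\<close>.\<close>

definition free_mod :: "'b set \<Rightarrow> ('b \<Rightarrow>\<^sub>0 'r::comm_ring_1) set"
  where "free_mod B = {u. Poly_Mapping.keys u \<subseteq> B}"

definition basis :: "'b \<Rightarrow> ('b \<Rightarrow>\<^sub>0 'r::comm_ring_1)"
  where "basis b = Poly_Mapping.single b 1"

text \<open>Maps between free modules are only ever considered on the carrier sets.\<close>

definition linear_on :: "'b set \<Rightarrow> 'c set \<Rightarrow> (('b \<Rightarrow>\<^sub>0 'r::comm_ring_1) \<Rightarrow> ('c \<Rightarrow>\<^sub>0 'r)) \<Rightarrow> bool"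
  where "linear_on B C f \<longleftrightarrow>
    (\<forall>u \<in> free_mod B. f u \<in> free_mod C) \<and>
    (\<forall>u \<in> free_mod B. \<forall>v \<in> free_mod B. f (u + v) = f u + f v) \<and>
    (\<forall>a. \<forall>u \<in> free_mod B. f (a \<cdot>\<^sub>f u) = a \<cdot>\<^sub>f f u)"

definition automorphism_on :: "'b set \<Rightarrow> (('b \<Rightarrow>\<^sub>0 'r::comm_ring_1) \<Rightarrow> ('b \<Rightarrow>\<^sub>0 'r)) \<Rightarrow> bool"
  where "automorphism_on B f \<longleftrightarrow> linear_on B B f \<and> bij_betw f (free_mod B) (free_mod B)"

definition lin_ext :: "('b \<Rightarrow> ('c \<Rightarrow>\<^sub>0 'r::comm_ring_1)) \<Rightarrow> ('b \<Rightarrow>\<^sub>0 'r) \<Rightarrow> ('c \<Rightarrow>\<^sub>0 'r)"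
  where "lin_ext f u = (\<Sum>b \<in> Poly_Mapping.keys u. Poly_Mapping.lookup u b \<cdot>\<^sub>f f b)"

text \<open>The tensor product of the free modules on \<open>B\<close> and \<open>C\<close> is the free module on
  \<open>B \<times> C\<close>, with the following universal bilinear map
  (see \<open>tensor_universal\<close> below).\<close>

definition tensor :: "('b \<Rightarrow>\<^sub>0 'r::comm_ring_1) \<Rightarrow> ('c \<Rightarrow>\<^sub>0 'r) \<Rightarrow> ('b \<times> 'c \<Rightarrow>\<^sub>0 'r)"
  where "tensor u v = (\<Sum>b \<in> Poly_Mapping.keys u. \<Sum>c \<in> Poly_Mapping.keys v.
    Poly_Mapping.single (b, c) (Poly_Mapping.lookup u b * Poly_Mapping.lookup v c))"

definition tensor_map ::
    "(('b \<Rightarrow>\<^sub>0 'r::comm_ring_1) \<Rightarrow> ('b' \<Rightarrow>\<^sub>0 'r)) \<Rightarrow> (('c \<Rightarrow>\<^sub>0 'r) \<Rightarrow> ('c' \<Rightarrow>\<^sub>0 'r)) \<Rightarrow>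
     ('b \<times> 'c \<Rightarrow>\<^sub>0 'r) \<Rightarrow> ('b' \<times> 'c' \<Rightarrow>\<^sub>0 'r)"
  where "tensor_map f g = lin_ext (\<lambda>(b, c). tensor (f (basis b)) (g (basis c)))"

definition assoc_left :: "('b \<times> ('c \<times> 'd) \<Rightarrow>\<^sub>0 'r::comm_ring_1) \<Rightarrow> (('b \<times> 'c) \<times> 'd \<Rightarrow>\<^sub>0 'r)"
  where "assoc_left = lin_ext (\<lambda>(b, (c, d)). basis ((b, c), d))"

definition assoc_right :: "(('b \<times> 'c) \<times> 'd \<Rightarrow>\<^sub>0 'r::comm_ring_1) \<Rightarrow> ('b \<times> ('c \<times> 'd) \<Rightarrow>\<^sub>0 'r)"
  where "assoc_right = lin_ext (\<lambda>((b, c), d). basis (b, (c, d)))"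


section \<open>Congruence modulo an ideal\<close>

definition principal_ideal :: "'r::comm_ring_1 \<Rightarrow> 'r set"
  where "principal_ideal a = {b. a dvd b}"

text \<open>The submodule \<open>\<mm>M\<close> of the free module \<open>M\<close> on \<open>B\<close>.\<close>

definition ideal_mod :: "'r::comm_ring_1 set \<Rightarrow> 'b set \<Rightarrow> ('b \<Rightarrow>\<^sub>0 'r) set"
  where "ideal_mod \<mm> B = fmod.span {a \<cdot>\<^sub>f u |a u. a \<in> \<mm> \<and> u \<in> free_mod B}"

definition cong_on ::
    "'r::comm_ring_1 set \<Rightarrow> 'b set \<Rightarrow> (('b \<Rightarrow>\<^sub>0 'r) \<Rightarrow> ('b \<Rightarrow>\<^sub>0 'r)) \<Rightarrow> (('b \<Rightarrow>\<^sub>0 'r) \<Rightarrow> ('b \<Rightarrow>\<^sub>0 'r)) \<Rightarrow> bool"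
  where "cong_on \<mm> B f g \<longleftrightarrow> (\<forall>u \<in> free_mod B. f u - g u \<in> ideal_mod \<mm> B)"


section \<open>Yang-Baxter operators and their deformations\<close>

text \<open>In all definitions below, \<open>V\<close> is the free module on \<open>Q\<close>; its threefold tensor power is
  bracketed as \<open>(V \<otimes> V) \<otimes> V\<close>.\<close>

type_synonym ('q, 'r) tensor_op = "('q \<times> 'q \<Rightarrow>\<^sub>0 'r) \<Rightarrow> ('q \<times> 'q \<Rightarrow>\<^sub>0 'r)"

definition act_left ::
    "('q, 'r::comm_ring_1) tensor_op \<Rightarrow> (('q \<times> 'q) \<times> 'q \<Rightarrow>\<^sub>0 'r) \<Rightarrow> (('q \<times> 'q) \<times> 'q \<Rightarrow>\<^sub>0 'r)"
  where "act_left c = tensor_map c id"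

definition act_right ::
    "('q, 'r::comm_ring_1) tensor_op \<Rightarrow> (('q \<times> 'q) \<times> 'q \<Rightarrow>\<^sub>0 'r) \<Rightarrow> (('q \<times> 'q) \<times> 'q \<Rightarrow>\<^sub>0 'r)"
  where "act_right c = assoc_left \<circ> tensor_map id c \<circ> assoc_right"

definition yb_operator :: "'q set \<Rightarrow> ('q, 'r::comm_ring_1) tensor_op \<Rightarrow> bool"
  where "yb_operator Q c \<longleftrightarrow>
    automorphism_on (Q \<times> Q) c \<and>
    (\<forall>w \<in> free_mod ((Q \<times> Q) \<times> Q).
      act_left c (act_right c (act_left c w)) = act_right c (act_left c (act_right c w)))"

definition yb_deformation ::
    "'r::comm_ring_1 set \<Rightarrow> 'q set \<Rightarrow> ('q, 'r) tensor_op \<Rightarrow> ('q, 'r) tensor_op \<Rightarrow> bool"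
  where "yb_deformation \<mm> Q c c' \<longleftrightarrow> yb_operator Q c' \<and> cong_on \<mm> (Q \<times> Q) c' c"

definition yb_equiv ::
    "'r::comm_ring_1 set \<Rightarrow> 'q set \<Rightarrow> ('q, 'r) tensor_op \<Rightarrow> ('q, 'r) tensor_op \<Rightarrow> bool"
  where "yb_equiv \<mm> Q c c' \<longleftrightarrow>
    yb_operator Q c \<and> yb_operator Q c' \<and>
    (\<exists>\<alpha>. automorphism_on Q \<alpha> \<and> cong_on \<mm> Q \<alpha> id \<and>
      (\<forall>w \<in> free_mod (Q \<times> Q).
        c' w = tensor_map \<alpha> \<alpha> (c (inv_into (free_mod (Q \<times> Q)) (tensor_map \<alpha> \<alpha>) w))))"

definition rescale :: "'r::comm_ring_1 \<Rightarrow> ('q, 'r) tensor_op \<Rightarrow> ('q, 'r) tensor_op"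
  where "rescale s c = (\<lambda>w. s \<cdot>\<^sub>f c w)"

definition yb_trivial ::
    "'r::comm_ring_1 set \<Rightarrow> 'q set \<Rightarrow> ('q, 'r) tensor_op \<Rightarrow> ('q, 'r) tensor_op \<Rightarrow> bool"
  where "yb_trivial \<mm> Q c c' \<longleftrightarrow>
    yb_equiv \<mm> Q c c' \<or> (\<exists>s \<in> (+) 1 ` \<mm>. yb_equiv \<mm> Q (rescale s c) c')"

definition yb_rigid :: "'r::comm_ring_1 set \<Rightarrow> 'q set \<Rightarrow> ('q, 'r) tensor_op \<Rightarrow> bool"
  where "yb_rigid \<mm> Q c \<longleftrightarrow>
    yb_operator Q c \<and> (\<forall>c'. yb_deformation \<mm> Q c c' \<longrightarrow> yb_trivial \<mm> Q c c')"


section \<open>Conjugacy classes and their Yang-Baxter operators\<close>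

definition centre :: "('g, 'b) monoid_scheme \<Rightarrow> 'g set"
  where "centre G = {z \<in> carrier G. \<forall>x \<in> carrier G. z \<otimes>\<^bsub>G\<^esub> x = x \<otimes>\<^bsub>G\<^esub> z}"

definition conj_op :: "('g, 'b) monoid_scheme \<Rightarrow> 'g \<Rightarrow> 'g \<Rightarrow> 'g"
  where "conj_op G x y = inv\<^bsub>G\<^esub> y \<otimes>\<^bsub>G\<^esub> x \<otimes>\<^bsub>G\<^esub> y"

definition conjugacy_class :: "('g, 'b) monoid_scheme \<Rightarrow> 'g set \<Rightarrow> bool"
  where "conjugacy_class G Q \<longleftrightarrow> (\<exists>x \<in> carrier G. Q = conj_op G x ` carrier G)"

definition rack_op :: "('q \<Rightarrow> 'q \<Rightarrow> 'q) \<Rightarrow> ('q, 'r::comm_ring_1) tensor_op"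
  where "rack_op star = lin_ext (\<lambda>(x, y). tensor (basis y) (basis (star x y)))"


section \<open>Basic facts\<close>

lemma basis_in_free_mod [simp]: "basis b \<in> free_mod B \<longleftrightarrow> b \<in> B"
  by (simp add: basis_def free_mod_def)

lemma free_mod_iff: "u \<in> free_mod B \<longleftrightarrow> (\<forall>b. b \<notin> B \<longrightarrow> Poly_Mapping.lookup u b = 0)"
  by (auto simp: free_mod_def in_keys_iff subset_iff)

lemma free_mod_subspace: "fmod.subspace (free_mod B)"
  by (rule fmod.subspaceI) (auto simp: free_mod_iff lookup_add)

lemma lin_ext_superset:
  assumes "finite A" "Poly_Mapping.keys u \<subseteq> A"
  shows "lin_ext f u = (\<Sum>b \<in> A. Poly_Mapping.lookup u b \<cdot>\<^sub>f f b)"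
  unfolding lin_ext_def using assms
  by (intro sum.mono_neutral_left) (auto simp: in_keys_iff)

lemma lin_ext_basis [simp]: "lin_ext f (basis b) = f b"
  by (simp add: lin_ext_def basis_def)

lemma lin_ext_add: "lin_ext f (u + v) = lin_ext f u + lin_ext f v"
proof -
  let ?A = "Poly_Mapping.keys u \<union> Poly_Mapping.keys v"
  have "Poly_Mapping.keys (u + v) \<subseteq> ?A" by (rule Poly_Mapping.keys_add)
  then show ?thesis
    by (simp add: lin_ext_superset[of ?A] lookup_add fmod.scale_left_distrib sum.distrib)
qed

lemma lin_ext_scale: "lin_ext f (a \<cdot>\<^sub>f u) = a \<cdot>\<^sub>f lin_ext f u"
proof -
  have "Poly_Mapping.keys (a \<cdot>\<^sub>f u) \<subseteq> Poly_Mapping.keys u" by (auto simp: in_keys_iff)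
  then show ?thesis
    by (simp add: lin_ext_superset[of "Poly_Mapping.keys u"] fmod.scale_sum_right)
qed

lemma lin_ext_linear:
  assumes "\<And>b. b \<in> B \<Longrightarrow> f b \<in> free_mod C"
  shows "linear_on B C (lin_ext f)"
proof -
  have "lin_ext f u \<in> free_mod C" if "u \<in> free_mod B" for u
    unfolding lin_ext_def
    by (intro fmod.subspace_sum fmod.subspace_scale free_mod_subspace assms)
      (use that in \<open>auto simp: free_mod_def\<close>)
  then show ?thesis by (simp add: linear_on_def lin_ext_add lin_ext_scale)
qed

lemma lin_ext_id: "lin_ext basis u = u"
proof (rule poly_mapping_eqI)
  fix k
  have "Poly_Mapping.lookup (lin_ext basis u) k =
      (\<Sum>b \<in> Poly_Mapping.keys u. if b = k then Poly_Mapping.lookup u k else 0)"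
    unfolding lin_ext_def lookup_sum
    by (intro sum.cong refl) (auto simp: basis_def lookup_single when_def)
  also have "\<dots> = Poly_Mapping.lookup u k" by (simp add: in_keys_iff)
  finally show "Poly_Mapping.lookup (lin_ext basis u) k = Poly_Mapping.lookup u k" .
qed

lemma linear_on_eq_lin_ext:
  fixes f :: "('b \<Rightarrow>\<^sub>0 'r::comm_ring_1) \<Rightarrow> ('c \<Rightarrow>\<^sub>0 'r)"
  assumes f: "linear_on B C f" and u: "u \<in> free_mod B"
  shows "f u = lin_ext (\<lambda>b. f (basis b)) u"
proof -
  have 0: "0 \<in> free_mod B" by (simp add: free_mod_def)
  have "f (0 \<cdot>\<^sub>f 0) = 0 \<cdot>\<^sub>f f 0" using f 0 unfolding linear_on_def by blast
  then have f0: "f 0 = 0" by simp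
  have "f (\<Sum>b \<in> A. a b \<cdot>\<^sub>f basis b) = (\<Sum>b \<in> A. a b \<cdot>\<^sub>f f (basis b))"
    if "finite A" "A \<subseteq> B" for A a
    using that
  proof (induction A rule: finite_induct)
    case (insert x A)
    have "a x \<cdot>\<^sub>f basis x \<in> free_mod B" "(\<Sum>b \<in> A. a b \<cdot>\<^sub>f basis b) \<in> free_mod B"
      using insert.prems
      by (auto intro!: fmod.subspace_sum fmod.subspace_scale free_mod_subspace)
    moreover have "(basis x :: 'b \<Rightarrow>\<^sub>0 'r) \<in> free_mod B" using insert.prems by simp
    ultimately show ?case using insert f by (simp add: linear_on_def)
  qed (simp add: f0)
  from this[of "Poly_Mapping.keys u" "Poly_Mapping.lookup u"] u
  have "f (lin_ext basis u) = lin_ext (\<lambda>b. f (basis b)) u"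
    by (simp add: lin_ext_def free_mod_def)
  then show ?thesis by (simp add: lin_ext_id)
qed

lemma lookup_tensor [simp]:
  "Poly_Mapping.lookup (tensor u v) (b, c) = Poly_Mapping.lookup u b * Poly_Mapping.lookup v c"
proof -
  have "Poly_Mapping.lookup (tensor u v) (b, c) =
      (\<Sum>x \<in> Poly_Mapping.keys u. \<Sum>y \<in> Poly_Mapping.keys v.
        if y = c then (if x = b then Poly_Mapping.lookup u b * Poly_Mapping.lookup v c else 0) else 0)"
    unfolding tensor_def lookup_sum
    by (intro sum.cong refl) (auto simp: lookup_single when_def)
  also have "\<dots> = Poly_Mapping.lookup u b * Poly_Mapping.lookup v c"
    by (cases "Poly_Mapping.lookup u b = 0"; cases "Poly_Mapping.lookup v c = 0")
      (auto simp: in_keys_iff)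
  finally show ?thesis .
qed

lemma tensor_add_left: "tensor (u + u') v = tensor u v + tensor u' v"
  and tensor_add_right: "tensor u (v + v') = tensor u v + tensor u v'"
  and tensor_scale_left: "tensor (a \<cdot>\<^sub>f u) v = a \<cdot>\<^sub>f tensor u v"
  and tensor_scale_right: "tensor u (a \<cdot>\<^sub>f v) = a \<cdot>\<^sub>f tensor u v"
  by (rule poly_mapping_eqI; clarsimp simp: lookup_add algebra_simps)+

lemma tensor_basis: "tensor (basis b) (basis c) = basis (b, c)"
  by (rule poly_mapping_eqI) (auto simp: basis_def lookup_single when_def split: if_splits)

lemma tensor_in_free_mod: "u \<in> free_mod B \<Longrightarrow> v \<in> free_mod C \<Longrightarrow> tensor u v \<in> free_mod (B \<times> C)"
  by (auto simp: free_mod_iff)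

lemma tensor_map_linear:
  assumes "linear_on B B' f" "linear_on C C' g"
  shows "linear_on (B \<times> C) (B' \<times> C') (tensor_map f g)"
  unfolding tensor_map_def
  by (rule lin_ext_linear) (use assms in \<open>auto simp: linear_on_def intro!: tensor_in_free_mod\<close>)

lemma lin_ext_tensor:
  "lin_ext h (tensor u v) = lin_ext (\<lambda>b. lin_ext (\<lambda>c. h (b, c)) v) u"
proof -
  have "Poly_Mapping.keys (tensor u v) \<subseteq> Poly_Mapping.keys u \<times> Poly_Mapping.keys v"
    by (auto simp: in_keys_iff)
  then have "lin_ext h (tensor u v) =
      (\<Sum>p \<in> Poly_Mapping.keys u \<times> Poly_Mapping.keys v. Poly_Mapping.lookup (tensor u v) p \<cdot>\<^sub>f h p)"
    by (intro lin_ext_superset) auto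
  also have "\<dots> = (\<Sum>b \<in> Poly_Mapping.keys u. \<Sum>c \<in> Poly_Mapping.keys v.
      (Poly_Mapping.lookup u b * Poly_Mapping.lookup v c) \<cdot>\<^sub>f h (b, c))"
    by (simp add: sum.cartesian_product split_beta flip: lookup_tensor)
  also have "\<dots> = lin_ext (\<lambda>b. lin_ext (\<lambda>c. h (b, c)) v) u"
    by (simp add: lin_ext_def fmod.scale_sum_right)
  finally show ?thesis .
qed

text \<open>Bilinear maps out of two free modules factor uniquely through \<open>tensor\<close>.\<close>

lemma tensor_universal:
  fixes \<beta> :: "('b \<Rightarrow>\<^sub>0 'r::comm_ring_1) \<Rightarrow> ('c \<Rightarrow>\<^sub>0 'r) \<Rightarrow> ('d \<Rightarrow>\<^sub>0 'r)"
  assumes "\<And>v. v \<in> free_mod C \<Longrightarrow> linear_on B D (\<lambda>u. \<beta> u v)"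
    and "\<And>u. u \<in> free_mod B \<Longrightarrow> linear_on C D (\<beta> u)"
  shows "\<exists>h. linear_on (B \<times> C) D h \<and>
      (\<forall>u \<in> free_mod B. \<forall>v \<in> free_mod C. h (tensor u v) = \<beta> u v)"
    and "linear_on (B \<times> C) D h \<Longrightarrow> linear_on (B \<times> C) D h' \<Longrightarrow>
      (\<And>u v. u \<in> free_mod B \<Longrightarrow> v \<in> free_mod C \<Longrightarrow> h (tensor u v) = \<beta> u v) \<Longrightarrow>
      (\<And>u v. u \<in> free_mod B \<Longrightarrow> v \<in> free_mod C \<Longrightarrow> h' (tensor u v) = \<beta> u v) \<Longrightarrow>
      w \<in> free_mod (B \<times> C) \<Longrightarrow> h w = h' w"
proof -
  let ?h = "lin_ext (\<lambda>(b, c). \<beta> (basis b) (basis c))"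
  have "linear_on (B \<times> C) D ?h"
    by (rule lin_ext_linear) (use assms in \<open>auto simp: linear_on_def\<close>)
  moreover have "?h (tensor u v) = \<beta> u v" if u: "u \<in> free_mod B" and v: "v \<in> free_mod C" for u v
  proof -
    have "?h (tensor u v) = lin_ext (\<lambda>b. lin_ext (\<lambda>c. \<beta> (basis b) (basis c)) v) u"
      by (simp add: lin_ext_tensor)
    also have "\<dots> = lin_ext (\<lambda>b. \<beta> (basis b) v) u"
      unfolding lin_ext_def[of _ u]
    proof (intro sum.cong refl)
      fix b assume "b \<in> Poly_Mapping.keys u"
      with u have "(basis b :: 'b \<Rightarrow>\<^sub>0 'r) \<in> free_mod B" by (auto simp: free_mod_def basis_def)
      from linear_on_eq_lin_ext[OF assms(2)[OF this] v]
      show "Poly_Mapping.lookup u b \<cdot>\<^sub>f lin_ext (\<lambda>c. \<beta> (basis b) (basis c)) v =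
        Poly_Mapping.lookup u b \<cdot>\<^sub>f \<beta> (basis b) v" by simp
    qed
    also have "\<dots> = \<beta> u v" using linear_on_eq_lin_ext[OF assms(1)[OF v] u] by simp
    finally show ?thesis .
  qed
  ultimately show "\<exists>h. linear_on (B \<times> C) D h \<and>
      (\<forall>u \<in> free_mod B. \<forall>v \<in> free_mod C. h (tensor u v) = \<beta> u v)" by blast
next
  assume h: "linear_on (B \<times> C) D h" "linear_on (B \<times> C) D h'"
    and eq: "\<And>u v. u \<in> free_mod B \<Longrightarrow> v \<in> free_mod C \<Longrightarrow> h (tensor u v) = \<beta> u v"
      "\<And>u v. u \<in> free_mod B \<Longrightarrow> v \<in> free_mod C \<Longrightarrow> h' (tensor u v) = \<beta> u v"
    and w: "w \<in> free_mod (B \<times> C)"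
  have "h (basis p) = h' (basis p)" if "p \<in> B \<times> C" for p
    using eq[of "basis (fst p)" "basis (snd p)"] that by (auto simp: tensor_basis)
  then have "lin_ext (\<lambda>p. h (basis p)) w = lin_ext (\<lambda>p. h' (basis p)) w"
    using w unfolding lin_ext_def free_mod_def by (intro sum.cong) auto
  with h w show "h w = h' w" by (simp add: linear_on_eq_lin_ext)
qed

lemma lin_ext_tensor_right: "lin_ext (\<lambda>c. tensor x (k c)) y = tensor x (lin_ext k y)"
  and lin_ext_tensor_left: "lin_ext (\<lambda>b. tensor (k b) x) y = tensor (lin_ext k y) x"
  by (rule poly_mapping_eqI;
      clarsimp simp: lin_ext_def lookup_sum sum_distrib_left sum_distrib_right mult_ac)+

lemma tensor_map_tensor:
  assumes f: "linear_on B B' f" and g: "linear_on C C' g"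
    and u: "u \<in> free_mod B" and v: "v \<in> free_mod C"
  shows "tensor_map f g (tensor u v) = tensor (f u) (g v)"
proof -
  have "tensor_map f g (tensor u v) =
      tensor (lin_ext (\<lambda>b. f (basis b)) u) (lin_ext (\<lambda>c. g (basis c)) v)"
    by (simp only: tensor_map_def lin_ext_tensor prod.case lin_ext_tensor_left lin_ext_tensor_right)
  then show ?thesis
    using linear_on_eq_lin_ext[OF f u] linear_on_eq_lin_ext[OF g v] by simp
qed

lemma assoc_left_tensor: "assoc_left (tensor u (tensor v w)) = tensor (tensor u v) w"
  by (simp only: assoc_left_def lin_ext_tensor prod.case lin_ext_tensor_left lin_ext_tensor_right
      lin_ext_id flip: tensor_basis)

lemma assoc_right_tensor: "assoc_right (tensor (tensor u v) w) = tensor u (tensor v w)"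
  by (simp only: assoc_right_def lin_ext_tensor prod.case lin_ext_tensor_left lin_ext_tensor_right
      lin_ext_id flip: tensor_basis)

lemma rack_op_basis: "rack_op star (tensor (basis x) (basis y)) = tensor (basis y) (basis (star x y))"
  by (simp add: rack_op_def tensor_basis)

lemma ideal_mod_iff:
  assumes 0: "0 \<in> \<mm>" and add: "\<And>a b. a \<in> \<mm> \<Longrightarrow> b \<in> \<mm> \<Longrightarrow> a + b \<in> \<mm>"
    and mult: "\<And>a b. b \<in> \<mm> \<Longrightarrow> a * b \<in> \<mm>"
  shows "u \<in> ideal_mod \<mm> B \<longleftrightarrow> u \<in> free_mod B \<and> (\<forall>b. Poly_Mapping.lookup u b \<in> \<mm>)"
proof
  let ?S = "{u \<in> free_mod B. \<forall>b. Poly_Mapping.lookup u b \<in> \<mm>}"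
  have "fmod.subspace ?S"
    using free_mod_subspace[of B]
    by (auto simp: fmod.subspace_def lookup_add intro!: 0 add mult)
  moreover have "{a \<cdot>\<^sub>f u |a u. a \<in> \<mm> \<and> u \<in> free_mod B} \<subseteq> ?S"
    using mult by (auto intro!: fmod.subspace_scale free_mod_subspace simp: mult.commute)
  ultimately have "ideal_mod \<mm> B \<subseteq> ?S"
    unfolding ideal_mod_def by (intro fmod.span_minimal)
  then show "u \<in> ideal_mod \<mm> B \<Longrightarrow> u \<in> free_mod B \<and> (\<forall>b. Poly_Mapping.lookup u b \<in> \<mm>)"
    by auto
next
  assume u: "u \<in> free_mod B \<and> (\<forall>b. Poly_Mapping.lookup u b \<in> \<mm>)"
  have "lin_ext basis u \<in> ideal_mod \<mm> B"
    unfolding lin_ext_def ideal_mod_def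
  proof (intro fmod.span_sum fmod.span_base CollectI exI conjI refl)
    fix b assume "b \<in> Poly_Mapping.keys u"
    with u show "basis b \<in> free_mod B" by (auto simp: free_mod_def basis_def)
  qed (use u in auto)
  then show "u \<in> ideal_mod \<mm> B" by (simp add: lin_ext_id)
qed

end

theory Submission
  imports Defs
begin

text \<open>Let \<open>V\<close> be the free module on \<open>Q\<close> over the power series in \<open>h\<close>, and let \<open>c\<close> be a Yang-Baxter deformation of the permutation
  operator \<open>c\<^sub>Q\<close>. What is wanted is a map \<open>\<alpha>\<close> congruent to the identity and a scalar
  \<open>s \<equiv> 1\<close> with \<open>c (\<alpha> \<otimes> \<alpha>) = s (\<alpha> \<otimes> \<alpha>) c\<^sub>Q\<close>. They are built one power of \<open>h\<close> at a time. Suppose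
  \<open>c (\<alpha> \<otimes> \<alpha>) = s (\<alpha> \<otimes> \<alpha>) c\<^sub>Q + h\<^sup>n D\<close> with \<open>n > 0\<close>. Comparing both sides of the Yang-Baxter
  equation for \<open>c\<close> on \<open>\<alpha> \<otimes> \<alpha> \<otimes> \<alpha>\<close>, the terms without \<open>D\<close> cancel because \<open>c\<^sub>Q\<close> is a
  Yang-Baxter operator, and what is left, taken modulo \<open>h\<close>, is a linear equation for the endomorphism
  \<open>f = c\<^sub>Q\<^bsup>-1\<^esup> D\<close>: it is a 2-cocycle (\<open>leading_error_cocycle\<close>). Replacing \<open>\<alpha>\<close> by \<open>\<alpha> + h\<^sup>n a\<close> and \<open>s\<close>
  by \<open>s + h\<^sup>n \<mu>\<close> subtracts from \<open>f\<close> the coboundary of \<open>a\<close> and \<open>\<mu>\<close> times the identity. So the induction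
  goes through (\<open>improve_intertwiner\<close>) as soon as every 2-cocycle over a field of characteristic 0 is a
  coboundary plus a multiple of the identity. The coefficients of \<open>\<alpha>\<close> and \<open>s\<close> stabilise, and their
  limit is an exact intertwiner (\<open>intertwiner_exists\<close>); \<open>\<alpha>\<close> is invertible because it is the identity
  modulo \<open>h\<close>.

  The heart is therefore the computation of the cocycles (\<open>cocycle_trivial\<close>), where \<open>f x y u v\<close> is the
  coefficient of \<open>u \<otimes> v\<close> in \<open>f (x \<otimes> y)\<close>. The cocycle equation has three inputs \<open>x, y, z\<close> and three
  outputs \<open>u, v, w\<close>. Where \<open>w = z\<close>, it says that conjugating all arguments of \<open>f\<close> by \<open>z\<close> changes
  \<open>f\<close> by a coboundary. As \<open>Q\<close> generates \<open>G\<close>, this holds for conjugation by every element of \<open>G\<close>,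
  so averaging over \<open>G\<close> reduces the problem to a cocycle that is invariant under \<open>G\<close>.

  For an invariant cocycle the two terms of the equation that differ by a conjugation cancel. Two
  different elements \<open>y, v\<close> of a centreless group generated by \<open>Q\<close> act differently on some \<open>x \<in> Q\<close>;
  inserting this \<open>x\<close> in the equation for \<open>w = z\<close> shows \<open>f y z v z = 0\<close>, and the remaining values
  \<open>f y z y z\<close> are all equal since \<open>G\<close> is transitive on \<open>Q\<close>. This is
  the multiple of the identity. For \<open>w \<noteq> z\<close> the same idea, applied to a pair \<open>y \<noteq> v\<close> whose conjugates
  by \<open>z\<close> and \<open>w\<close> coincide, expresses all \<open>f x z u w\<close> through the single number \<open>a z w = f y z v w\<close>,
  in exactly the way in which they occur in the coboundary of \<open>a\<close>.\<close>

unbundle fps_syntax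

section \<open>A class that generates a centreless group\<close>

locale centreless_class = group G for G (structure) +
  fixes Q
  assumes fin: "finite (carrier G)"
    and trivial_centre: "centre G = {\<one>}"
    and conj_class: "conjugacy_class G Q"
    and gen: "generate G Q = carrier G"
begin

abbreviation conj_by (infixl \<open>\<triangleleft>\<close> 70) where "x \<triangleleft> g \<equiv> conj_op G x g"

lemma conj_closed [simp]: "x \<in> carrier G \<Longrightarrow> g \<in> carrier G \<Longrightarrow> x \<triangleleft> g \<in> carrier G"
  by (simp add: conj_op_def)

lemma conj_mult:
  "x \<in> carrier G \<Longrightarrow> g \<in> carrier G \<Longrightarrow> h \<in> carrier G \<Longrightarrow> x \<triangleleft> (g \<otimes> h) = x \<triangleleft> g \<triangleleft> h"
  by (simp add: conj_op_def inv_mult_group m_assoc)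

lemma conj_one [simp]: "x \<in> carrier G \<Longrightarrow> x \<triangleleft> \<one> = x"
  by (simp add: conj_op_def)

lemma conj_inv_cancel [simp]:
  assumes "x \<in> carrier G" "g \<in> carrier G"
  shows "x \<triangleleft> g \<triangleleft> inv g = x" "x \<triangleleft> inv g \<triangleleft> g = x"
  using assms conj_mult[of x g "inv g"] conj_mult[of x "inv g" g] by simp_all

lemma conj_inj [simp]:
  assumes "x \<in> carrier G" "y \<in> carrier G" "g \<in> carrier G"
  shows "x \<triangleleft> g = y \<triangleleft> g \<longleftrightarrow> x = y"
  using assms conj_inv_cancel(1) by metis

lemma mult_conj: "x \<in> carrier G \<Longrightarrow> g \<in> carrier G \<Longrightarrow> g \<otimes> (x \<triangleleft> g) = x \<otimes> g"
  by (simp add: conj_op_def m_assoc[symmetric])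

text \<open>Self-distributivity of the rack operation, valid for all elements of the group.\<close>

lemma conj_conj:
  assumes "x \<in> carrier G" "y \<in> carrier G" "g \<in> carrier G"
  shows "x \<triangleleft> g \<triangleleft> (y \<triangleleft> g) = x \<triangleleft> y \<triangleleft> g"
  using assms by (simp add: conj_mult[symmetric] mult_conj)

lemma Q_sub: "x \<in> Q \<Longrightarrow> x \<in> carrier G"
  using conj_class by (auto simp: conjugacy_class_def)

lemma fin_Q [simp]: "finite Q"
  using finite_subset[OF _ fin] Q_sub by blast

lemma Q_conj [simp]: "x \<in> Q \<Longrightarrow> g \<in> carrier G \<Longrightarrow> x \<triangleleft> g \<in> Q"
  using conj_class by (auto simp: conjugacy_class_def conj_mult[symmetric])

lemma Q_trans:
  assumes "x \<in> Q" "y \<in> Q" obtains g where "g \<in> carrier G" "y = x \<triangleleft> g"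
proof -
  obtain q where q: "q \<in> carrier G" "Q = (\<triangleleft>) q ` carrier G"
    using conj_class by (auto simp: conjugacy_class_def)
  then obtain g h where "g \<in> carrier G" "h \<in> carrier G" "x = q \<triangleleft> g" "y = q \<triangleleft> h"
    using assms by auto
  then have "y = x \<triangleleft> (inv g \<otimes> h)" "inv g \<otimes> h \<in> carrier G" using q by (auto simp: conj_mult)
  then show ?thesis by (rule that[rotated])
qed

text \<open>If \<open>g\<close> and \<open>h\<close> act alike on \<open>Q\<close>, then \<open>g h\<^bsup>-1\<^esup>\<close> commutes with \<open>Q\<close>, hence with the group that
  \<open>Q\<close> generates, hence is trivial.\<close>

lemma faithful:
  assumes g: "g \<in> carrier G" and h: "h \<in> carrier G" and eq: "\<And>x. x \<in> Q \<Longrightarrow> x \<triangleleft> g = x \<triangleleft> h"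
  shows "g = h"
proof -
  define k where "k = g \<otimes> inv h"
  have k: "k \<in> carrier G" using g h by (simp add: k_def)
  have comm: "k \<otimes> x = x \<otimes> k" if "x \<in> Q" for x
  proof -
    have "x \<triangleleft> k = x" using eq[OF that] that g h Q_sub by (simp add: k_def conj_mult)
    then show ?thesis using mult_conj[of x k] k Q_sub[OF that] by simp
  qed
  have "k \<otimes> x = x \<otimes> k" if "x \<in> generate G Q" for x
    using that
  proof induction
    case (inv x)
    then have x: "x \<in> carrier G" using Q_sub by simp
    have "k \<otimes> inv x = inv x \<otimes> (x \<otimes> k) \<otimes> inv x" using x k by (simp add: m_assoc[symmetric])
    also have "\<dots> = inv x \<otimes> (k \<otimes> x) \<otimes> inv x" using comm[OF inv] by simp
    also have "\<dots> = inv x \<otimes> k" using x k by (simp add: m_assoc)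
    finally show ?case .
  next
    case (eng x y)
    then have "x \<in> carrier G" "y \<in> carrier G" using gen by auto
    then show ?case using eng.IH k by (metis m_assoc)
  qed (use k comm in auto)
  then have "k \<in> centre G" using k gen by (auto simp: centre_def)
  then have "g \<otimes> inv h = \<one>" using trivial_centre k_def by auto
  then show ?thesis using g h by (metis inv_equality inv_inv inv_closed)
qed

lemma generation_induct [consumes 1, case_names one base inverse mult]:
  assumes "g \<in> carrier G" and "P \<one>" and "\<And>z. z \<in> Q \<Longrightarrow> P z"
    and "\<And>g. g \<in> carrier G \<Longrightarrow> P g \<Longrightarrow> P (inv g)"
    and "\<And>g h. g \<in> carrier G \<Longrightarrow> h \<in> carrier G \<Longrightarrow> P g \<Longrightarrow> P h \<Longrightarrow> P (g \<otimes> h)"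
  shows "P g"
proof -
  have "g \<in> generate G Q" using assms(1) gen by simp
  then show ?thesis
    by induction (use assms Q_sub gen in auto)
qed

section \<open>Infinitesimal deformations: cocycles modulo coboundaries\<close>

text \<open>An endomorphism \<open>f\<close> of \<open>V \<otimes> V\<close> is given by its coefficients \<open>f x y u v\<close> of \<open>u \<otimes> v\<close> in
  \<open>f (x \<otimes> y)\<close>. The coboundary of \<open>a\<close> is \<open>c\<^sub>Q\<^bsup>-1\<^esup> A c\<^sub>Q - A\<close> with \<open>A = a \<otimes> I + I \<otimes> a\<close>: the first-order
  effect of conjugating \<open>c\<^sub>Q\<close> by \<open>I + h a\<close>.\<close>

definition coboundary :: "('a \<Rightarrow> 'a \<Rightarrow> 'k::field_char_0) \<Rightarrow> 'a \<Rightarrow> 'a \<Rightarrow> 'a \<Rightarrow> 'a \<Rightarrow> 'k" where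
  "coboundary a x y u v =
     a y v * (of_bool (x \<triangleleft> y = u \<triangleleft> v) - of_bool (x = u)) +
     (a (x \<triangleleft> y) (u \<triangleleft> v) - a x u) * of_bool (y = v)"

text \<open>The linearised Yang-Baxter equation for \<open>c\<^sub>Q (I + h f)\<close>. With \<open>c\<^sub>1 = c\<^sub>Q \<otimes> I\<close>, \<open>c\<^sub>2 = I \<otimes> c\<^sub>Q\<close> and
  likewise \<open>f\<^sub>1\<close>, \<open>f\<^sub>2\<close>, both sides are divided by \<open>c\<^sub>1 c\<^sub>2 c\<^sub>1 = c\<^sub>2 c\<^sub>1 c\<^sub>2\<close>, and the three terms on
  each side become conjugates of \<open>f\<^sub>1\<close> and \<open>f\<^sub>2\<close> by permutations of the basis of \<open>V \<otimes> V \<otimes> V\<close>.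
  The equation compares the coefficients at the input \<open>x, y, z\<close> and the output \<open>u, v, w\<close>.\<close>

definition cocycle :: "('a \<Rightarrow> 'a \<Rightarrow> 'a \<Rightarrow> 'a \<Rightarrow> 'k::field_char_0) \<Rightarrow> bool" where
  "cocycle f \<longleftrightarrow> (\<forall>x\<in>Q. \<forall>y\<in>Q. \<forall>z\<in>Q. \<forall>u\<in>Q. \<forall>v\<in>Q. \<forall>w\<in>Q.
     f y z v w * (of_bool (x \<triangleleft> y \<triangleleft> z = u \<triangleleft> v \<triangleleft> w) - of_bool (x = u))
     + f (x \<triangleleft> y) z (u \<triangleleft> v) w * of_bool (y = v)
     - f x z u w * of_bool (y \<triangleleft> z = v \<triangleleft> w)
     + (f x y u v - f (x \<triangleleft> z) (y \<triangleleft> z) (u \<triangleleft> w) (v \<triangleleft> w)) * of_bool (z = w) = 0)"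

abbreviation translate ::
    "'a \<Rightarrow> ('a \<Rightarrow> 'a \<Rightarrow> 'a \<Rightarrow> 'a \<Rightarrow> 'k) \<Rightarrow> 'a \<Rightarrow> 'a \<Rightarrow> 'a \<Rightarrow> 'a \<Rightarrow> 'k" where
  "translate g f x y u v \<equiv> f (x \<triangleleft> g) (y \<triangleleft> g) (u \<triangleleft> g) (v \<triangleleft> g)"

lemma cocycle_translate:
  assumes "cocycle f" "g \<in> carrier G" shows "cocycle (translate g f)"
  unfolding cocycle_def
proof (intro ballI)
  fix x y z u v w assume q: "x \<in> Q" "y \<in> Q" "z \<in> Q" "u \<in> Q" "v \<in> Q" "w \<in> Q"
  have e: "p \<triangleleft> g \<triangleleft> (r \<triangleleft> g) = p \<triangleleft> r \<triangleleft> g" if "p \<in> Q" "r \<in> Q" for p r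
    using that assms(2) conj_conj Q_sub by blast
  have i: "p \<triangleleft> g = r \<triangleleft> g \<longleftrightarrow> p = r" if "p \<in> Q" "r \<in> Q" for p r
    using that assms(2) conj_inj Q_sub by blast
  show "translate g f y z v w * (of_bool (x \<triangleleft> y \<triangleleft> z = u \<triangleleft> v \<triangleleft> w) - of_bool (x = u))
     + translate g f (x \<triangleleft> y) z (u \<triangleleft> v) w * of_bool (y = v)
     - translate g f x z u w * of_bool (y \<triangleleft> z = v \<triangleleft> w)
     + (translate g f x y u v - translate g f (x \<triangleleft> z) (y \<triangleleft> z) (u \<triangleleft> w) (v \<triangleleft> w)) * of_bool (z = w) = 0"
    using assms(1)[unfolded cocycle_def, rule_format, of "x \<triangleleft> g" "y \<triangleleft> g" "z \<triangleleft> g" "u \<triangleleft> g" "v \<triangleleft> g" "w \<triangleleft> g"]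
      q assms(2) by (simp add: e i Q_sub)
qed

lemma coboundary_translate:
  assumes "g \<in> carrier G" "x \<in> Q" "y \<in> Q" "u \<in> Q" "v \<in> Q"
  shows "translate g (coboundary a) x y u v = coboundary (\<lambda>x u. a (x \<triangleleft> g) (u \<triangleleft> g)) x y u v"
  using assms by (simp add: coboundary_def conj_conj Q_sub)

lemma coboundary_add: "coboundary a x y u v + coboundary b x y u v = coboundary (\<lambda>x u. a x u + b x u) x y u v"
  by (simp add: coboundary_def algebra_simps)

lemma coboundary_minus: "- coboundary a x y u v = coboundary (\<lambda>x u. - a x u) x y u v"
  by (simp add: coboundary_def algebra_simps)

lemma coboundary_scale: "c * coboundary a x y u v = coboundary (\<lambda>x u. c * a x u) x y u v"
  by (simp add: coboundary_def algebra_simps)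

lemma coboundary_zero [simp]: "coboundary (\<lambda>x u. 0) x y u v = 0"
  by (simp add: coboundary_def)

lemma coboundary_sum: "(\<Sum>i\<in>I. coboundary (a i) x y u v) = coboundary (\<lambda>x u. \<Sum>i\<in>I. a i x u) x y u v"
  by (induction I rule: infinite_finite_induct) (simp_all add: coboundary_add)

text \<open>The elements \<open>g\<close> that move \<open>f\<close> only by a coboundary form a subgroup, since conjugation preserves
  coboundaries. It contains each \<open>z \<in> Q\<close>: this is the cocycle equation at \<open>w = z\<close>, with
  \<open>a x u = - f x z u z\<close>.\<close>

lemma translate_homotopic:
  assumes f: "cocycle f" and g: "g \<in> carrier G"
  shows "\<exists>a. \<forall>x\<in>Q. \<forall>y\<in>Q. \<forall>u\<in>Q. \<forall>v\<in>Q. f x y u v = translate g f x y u v + coboundary a x y u v"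
  using g
proof (induction rule: generation_induct)
  case one
  show ?case by (intro exI[of _ "\<lambda>x u. 0"]) (simp add: Q_sub)
next
  case (base z)
  show ?case
  proof (intro exI ballI)
    fix x y u v assume q: "x \<in> Q" "y \<in> Q" "u \<in> Q" "v \<in> Q"
    show "f x y u v = translate z f x y u v + coboundary (\<lambda>x u. - f x z u z) x y u v"
      using f[unfolded cocycle_def, rule_format, of x y z u v z] q base
      by (simp add: coboundary_def Q_sub algebra_simps)
  qed
next
  case (inverse g)
  then obtain a where a: "\<And>x y u v. x \<in> Q \<Longrightarrow> y \<in> Q \<Longrightarrow> u \<in> Q \<Longrightarrow> v \<in> Q \<Longrightarrow>
      f x y u v = translate g f x y u v + coboundary a x y u v" by metis
  show ?case
  proof (intro exI ballI)
    fix x y u v assume q: "x \<in> Q" "y \<in> Q" "u \<in> Q" "v \<in> Q"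
    have "translate (inv g) f x y u v = f x y u v + translate (inv g) (coboundary a) x y u v"
      using a[of "x \<triangleleft> inv g" "y \<triangleleft> inv g" "u \<triangleleft> inv g" "v \<triangleleft> inv g"] q inverse.hyps
      by (simp add: Q_sub)
    then show "f x y u v = translate (inv g) f x y u v +
        coboundary (\<lambda>x u. - a (x \<triangleleft> inv g) (u \<triangleleft> inv g)) x y u v"
      using coboundary_translate[of "inv g" x y u v a] q inverse.hyps
      by (simp add: coboundary_minus[symmetric])
  qed
next
  case (mult g h)
  obtain a where a: "\<And>x y u v. x \<in> Q \<Longrightarrow> y \<in> Q \<Longrightarrow> u \<in> Q \<Longrightarrow> v \<in> Q \<Longrightarrow>
      f x y u v = translate g f x y u v + coboundary a x y u v" using mult.IH(1) by metis
  obtain b where b: "\<And>x y u v. x \<in> Q \<Longrightarrow> y \<in> Q \<Longrightarrow> u \<in> Q \<Longrightarrow> v \<in> Q \<Longrightarrow>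
      f x y u v = translate h f x y u v + coboundary b x y u v" using mult.IH(2) by metis
  show ?case
  proof (intro exI ballI)
    fix x y u v assume q: "x \<in> Q" "y \<in> Q" "u \<in> Q" "v \<in> Q"
    have "translate g f x y u v = translate (g \<otimes> h) f x y u v + translate g (coboundary b) x y u v"
      using b[of "x \<triangleleft> g" "y \<triangleleft> g" "u \<triangleleft> g" "v \<triangleleft> g"] q mult.hyps
      by (simp add: Q_sub conj_mult)
    then show "f x y u v = translate (g \<otimes> h) f x y u v +
        coboundary (\<lambda>x u. a x u + b (x \<triangleleft> g) (u \<triangleleft> g)) x y u v"
      using a[OF q] coboundary_translate[of g x y u v b] q mult.hyps
      by (simp add: coboundary_add[symmetric])
  qed
qed

definition average :: "('a \<Rightarrow> 'a \<Rightarrow> 'a \<Rightarrow> 'a \<Rightarrow> 'k::field_char_0) \<Rightarrow> 'a \<Rightarrow> 'a \<Rightarrow> 'a \<Rightarrow> 'a \<Rightarrow> 'k" where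
  "average f x y u v = (\<Sum>g\<in>carrier G. translate g f x y u v) / of_nat (order G)"

lemma order_nonzero: "order G \<noteq> 0"
  using fin by (simp add: order_gt_0_iff_finite[symmetric])

definition invariant :: "('a \<Rightarrow> 'a \<Rightarrow> 'a \<Rightarrow> 'a \<Rightarrow> 'k) \<Rightarrow> bool" where
  "invariant f \<longleftrightarrow> (\<forall>g\<in>carrier G. \<forall>x\<in>Q. \<forall>y\<in>Q. \<forall>u\<in>Q. \<forall>v\<in>Q. translate g f x y u v = f x y u v)"

lemma invariant_average: "invariant (average f)"
  unfolding invariant_def
proof (intro ballI)
  fix h x y u v assume assms: "h \<in> carrier G" "x \<in> Q" "y \<in> Q" "u \<in> Q" "v \<in> Q"
  have "(\<Sum>g\<in>carrier G. translate (h \<otimes> g) f x y u v) = (\<Sum>g\<in>carrier G. translate g f x y u v)"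
    by (rule sum.reindex_bij_witness[of _ "\<lambda>g. inv h \<otimes> g" "\<lambda>g. h \<otimes> g"])
      (use assms(1) in \<open>auto simp: m_assoc[symmetric]\<close>)
  then show "translate h (average f) x y u v = average f x y u v"
    using assms by (simp add: average_def conj_mult Q_sub cong: sum.cong)
qed

lemma cocycle_average:
  assumes "cocycle f" shows "cocycle (average f)"
  unfolding cocycle_def
proof (intro ballI)
  fix x y z u v w assume q: "x \<in> Q" "y \<in> Q" "z \<in> Q" "u \<in> Q" "v \<in> Q" "w \<in> Q"
  let ?T = "\<lambda>f. f y z v w * (of_bool (x \<triangleleft> y \<triangleleft> z = u \<triangleleft> v \<triangleleft> w) - of_bool (x = u))
     + f (x \<triangleleft> y) z (u \<triangleleft> v) w * of_bool (y = v)
     - f x z u w * of_bool (y \<triangleleft> z = v \<triangleleft> w)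
     + (f x y u v - f (x \<triangleleft> z) (y \<triangleleft> z) (u \<triangleleft> w) (v \<triangleleft> w)) * of_bool (z = w)"
  have "?T (average f) = (\<Sum>g\<in>carrier G. ?T (translate g f)) / of_nat (order G)"
    unfolding average_def
    by (simp only: sum.distrib sum_subtractf sum_distrib_right[symmetric] add_divide_distrib
        diff_divide_distrib left_diff_distrib times_divide_eq_left)
  also have "(\<Sum>g\<in>carrier G. ?T (translate g f)) = 0"
    using cocycle_translate[OF assms, unfolded cocycle_def] q by (intro sum.neutral ballI) blast
  finally show "?T (average f) = 0" by simp
qed

lemma average_homotopic:
  fixes f :: "'a \<Rightarrow> 'a \<Rightarrow> 'a \<Rightarrow> 'a \<Rightarrow> 'k::field_char_0"
  assumes f: "cocycle f"
  shows "\<exists>a. \<forall>x\<in>Q. \<forall>y\<in>Q. \<forall>u\<in>Q. \<forall>v\<in>Q. f x y u v = average f x y u v + coboundary a x y u v"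
proof -
  obtain a where a: "\<And>g x y u v. g \<in> carrier G \<Longrightarrow> x \<in> Q \<Longrightarrow> y \<in> Q \<Longrightarrow> u \<in> Q \<Longrightarrow> v \<in> Q \<Longrightarrow>
      f x y u v = translate g f x y u v + coboundary (a g) x y u v"
    using translate_homotopic[OF f] by metis
  let ?n = "of_nat (order G) :: 'k"
  show ?thesis
  proof (intro exI ballI)
    fix x y u v assume q: "x \<in> Q" "y \<in> Q" "u \<in> Q" "v \<in> Q"
    have "?n * f x y u v = (\<Sum>g\<in>carrier G. f x y u v)" by (simp add: order_def)
    also have "\<dots> = (\<Sum>g\<in>carrier G. translate g f x y u v + coboundary (a g) x y u v)"
      by (intro sum.cong refl a q)
    also have "\<dots> = ?n * average f x y u v + coboundary (\<lambda>x u. \<Sum>g\<in>carrier G. a g x u) x y u v"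
      by (simp add: average_def order_nonzero sum.distrib coboundary_sum)
    finally have "f x y u v = average f x y u v +
        (1 / ?n) * coboundary (\<lambda>x u. \<Sum>g\<in>carrier G. a g x u) x y u v"
      by (simp add: field_simps order_nonzero)
    then show "f x y u v = average f x y u v +
        coboundary (\<lambda>x u. (1 / ?n) * (\<Sum>g\<in>carrier G. a g x u)) x y u v"
      by (simp only: coboundary_scale)
  qed
qed

text \<open>At \<open>w = z\<close> the cocycle equation for an invariant \<open>f\<close> says that the coboundary of \<open>\<lambda>x u. f x z u z\<close>
  vanishes. Its value at \<open>y \<noteq> v\<close> forces \<open>f y z v z = 0\<close>, and its value at \<open>y = v\<close> makes \<open>f x z x z\<close>
  constant on the orbit of \<open>x\<close>. Simultaneous conjugation of \<open>x\<close> and \<open>z\<close> then makes the constant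
  independent of \<open>z\<close>.\<close>

lemma invariant_cocycle_diagonal:
  assumes f: "cocycle f"
    and "invariant f"
  shows "\<exists>\<mu>. \<forall>x\<in>Q. \<forall>z\<in>Q. \<forall>u\<in>Q. f x z u z = \<mu> * of_bool (x = u)"
proof -
  note inv = assms(2)[unfolded invariant_def, rule_format]
  have eq: "f y z v z * (of_bool (x \<triangleleft> y = u \<triangleleft> v) - of_bool (x = u))
      + (f (x \<triangleleft> y) z (u \<triangleleft> v) z - f x z u z) * of_bool (y = v) = 0"
    if q: "x \<in> Q" "y \<in> Q" "z \<in> Q" "u \<in> Q" "v \<in> Q" for x y z u v
    using f[unfolded cocycle_def, rule_format, of x y z u v z] q inv[of z x y u v]
    by (simp add: Q_sub algebra_simps)
  have off: "f y z v z = 0" if q: "y \<in> Q" "z \<in> Q" "v \<in> Q" "y \<noteq> v" for y z v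
  proof -
    \<comment> \<open>taking \<open>u = x\<close>, the first bracket of \<open>eq\<close> is \<open>-1\<close> for this \<open>x\<close>\<close>
    obtain x where "x \<in> Q" "x \<triangleleft> y \<noteq> x \<triangleleft> v" using faithful q Q_sub by metis
    then show ?thesis using eq[of x y z x v] q by simp
  qed
  have left: "f (x \<triangleleft> g) z (x \<triangleleft> g) z = f x z x z" if g: "g \<in> carrier G" and "x \<in> Q" "z \<in> Q" for g x z
    using g \<open>x \<in> Q\<close>
  proof (induction arbitrary: x rule: generation_induct)
    case (base y)
    then show ?case using eq[of x y z x y] that by simp
  next
    case (inverse g)
    then show ?case using inverse.IH[of "x \<triangleleft> inv g"] by (simp add: Q_sub)
  next
    case (mult g h)
    then show ?case by (simp add: conj_mult Q_sub)
  qed (simp add: Q_sub)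
  obtain q where q: "q \<in> Q" using conj_class by (auto simp: conjugacy_class_def)
  have "f x z x z = f q q q q" if x: "x \<in> Q" and z: "z \<in> Q" for x z
  proof -
    obtain g where g: "g \<in> carrier G" "z = q \<triangleleft> g" using Q_trans[OF q z] by blast
    obtain h where h: "h \<in> carrier G" "x = (q \<triangleleft> g) \<triangleleft> h" using Q_trans[OF Q_conj[OF q g(1)] x] by blast
    have "f x z x z = f (q \<triangleleft> g) (q \<triangleleft> g) (q \<triangleleft> g) (q \<triangleleft> g)"
      using left[of h "q \<triangleleft> g" z] h g q by simp
    then show ?thesis using inv[OF g(1) q q q q] by simp
  qed
  then show ?thesis using off by (intro exI[of _ "f q q q q"]) (auto simp: of_bool_def)
qed

text \<open>For \<open>z \<noteq> w\<close> choose \<open>y \<in> Q\<close> with different conjugates by \<open>z\<close> and \<open>w\<close>, and \<open>v\<close> whose conjugate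
  by \<open>w\<close> is that of \<open>y\<close> by \<open>z\<close>. Then \<open>y \<noteq> v\<close>, only two terms of the cocycle equation survive, and
  they express \<open>f x z u w\<close> for all \<open>x, u\<close> through \<open>a z w = f y z v w\<close>. Since \<open>f\<close> determines
  \<open>a z w\<close>, its invariance passes to \<open>a\<close>. Together with \<open>a z z = 0\<close>, this makes the coboundary of \<open>a\<close> vanish at
  \<open>z = w\<close>.\<close>

lemma invariant_cocycle_off_diagonal:
  assumes f: "cocycle f"
    and "invariant f"
  obtains a where "\<And>z. z \<in> Q \<Longrightarrow> a z z = 0"
    and "\<And>z w x u. z \<in> Q \<Longrightarrow> w \<in> Q \<Longrightarrow> z \<noteq> w \<Longrightarrow> x \<in> Q \<Longrightarrow> u \<in> Q \<Longrightarrow>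
      f x z u w = a z w * (of_bool (x \<triangleleft> z = u \<triangleleft> w) - of_bool (x = u))"
    and "\<And>g z w. g \<in> carrier G \<Longrightarrow> z \<in> Q \<Longrightarrow> w \<in> Q \<Longrightarrow> a (z \<triangleleft> g) (w \<triangleleft> g) = a z w"
proof -
  note inv = assms(2)[unfolded invariant_def, rule_format]
  have ex: "\<exists>b y v. y \<in> Q \<and> v \<in> Q \<and> y \<noteq> v \<and> y \<triangleleft> z = v \<triangleleft> w \<and>
      (\<forall>x\<in>Q. \<forall>u\<in>Q. f x z u w = b * (of_bool (x \<triangleleft> z = u \<triangleleft> w) - of_bool (x = u)))"
    if zw: "z \<in> Q" "w \<in> Q" "z \<noteq> w" for z w
  proof -
    obtain y where y: "y \<in> Q" "y \<triangleleft> z \<noteq> y \<triangleleft> w" using faithful zw Q_sub by metis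
    define v where "v = y \<triangleleft> z \<triangleleft> inv w"
    have v: "v \<in> Q" "v \<triangleleft> w = y \<triangleleft> z" using y zw by (auto simp: v_def Q_sub)
    then have "y \<noteq> v" using y by auto
    have "f x z u w = f y z v w * (of_bool (x \<triangleleft> z = u \<triangleleft> w) - of_bool (x = u))"
      if q: "x \<in> Q" "u \<in> Q" for x u
    proof -
      \<comment> \<open>both triple conjugates end in conjugation by the common value of \<open>y \<triangleleft> z\<close> and \<open>v \<triangleleft> w\<close>, which cancels\<close>
      have "x \<triangleleft> y \<triangleleft> z = x \<triangleleft> z \<triangleleft> (y \<triangleleft> z)" using q y zw by (simp add: conj_conj Q_sub)
      moreover have "u \<triangleleft> v \<triangleleft> w = u \<triangleleft> w \<triangleleft> (y \<triangleleft> z)"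
        using conj_conj[of u v w] q v zw by (simp add: Q_sub)
      ultimately have "x \<triangleleft> y \<triangleleft> z = u \<triangleleft> v \<triangleleft> w \<longleftrightarrow> x \<triangleleft> z = u \<triangleleft> w"
        using q y zw by (simp add: Q_sub)
      then show ?thesis
        using f[unfolded cocycle_def, rule_format, of x y z u v w] q y zw v \<open>y \<noteq> v\<close> by simp
    qed
    then show ?thesis using y v \<open>y \<noteq> v\<close> by metis
  qed
  then obtain b where b: "\<And>z w. z \<in> Q \<Longrightarrow> w \<in> Q \<Longrightarrow> z \<noteq> w \<Longrightarrow> \<exists>y v. y \<in> Q \<and> v \<in> Q \<and> y \<noteq> v \<and> y \<triangleleft> z = v \<triangleleft> w \<and>
      (\<forall>x\<in>Q. \<forall>u\<in>Q. f x z u w = b z w * (of_bool (x \<triangleleft> z = u \<triangleleft> w) - of_bool (x = u)))"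
    by metis
  \<comment> \<open>the values at \<open>z = w\<close> are not determined by \<open>f\<close>; 0 is invariant and adds nothing to the coboundary\<close>
  define a where "a z w = (if z = w then 0 else b z w)" for z w
  have form: "f x z u w = a z w * (of_bool (x \<triangleleft> z = u \<triangleleft> w) - of_bool (x = u))"
    if "z \<in> Q" "w \<in> Q" "z \<noteq> w" "x \<in> Q" "u \<in> Q" for z w x u
    using b[OF that(1,2,3)] that unfolding a_def by auto
  have "a (z \<triangleleft> g) (w \<triangleleft> g) = a z w" if g: "g \<in> carrier G" and zw: "z \<in> Q" "w \<in> Q" for g z w
  proof (cases "z = w")
    case False
    then obtain y v where yv: "y \<in> Q" "v \<in> Q" "y \<noteq> v" "y \<triangleleft> z = v \<triangleleft> w" using b zw by blast
    \<comment> \<open>at \<open>x = y\<close>, \<open>u = v\<close> the bracket is 1, so \<open>f\<close> determines \<open>a z w\<close>\<close>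
    have "a z w = f y z v w" using form[OF zw False yv(1,2)] yv by simp
    moreover have "a (z \<triangleleft> g) (w \<triangleleft> g) = translate g f y z v w"
      using form[of "z \<triangleleft> g" "w \<triangleleft> g" "y \<triangleleft> g" "v \<triangleleft> g"] False zw g yv by (simp add: Q_sub conj_conj)
    ultimately show ?thesis using inv[OF g yv(1) zw(1) yv(2) zw(2)] by simp
  qed (simp add: a_def)
  then show ?thesis using that[of a] form by (simp add: a_def)
qed

text \<open>The second Yang-Baxter cohomology of \<open>c\<^sub>Q\<close> over a field of characteristic 0 is spanned by the class
  of the identity, which corresponds to rescaling.\<close>

theorem cocycle_trivial:
  assumes f: "cocycle f"
  shows "\<exists>\<mu> a. \<forall>x\<in>Q. \<forall>y\<in>Q. \<forall>u\<in>Q. \<forall>v\<in>Q.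
    f x y u v = \<mu> * of_bool (x = u \<and> y = v) + coboundary a x y u v"
proof -
  let ?F = "average f"
  note F = cocycle_average[OF f] and inv = invariant_average[of f]
  obtain \<mu> where \<mu>: "\<And>x z u. x \<in> Q \<Longrightarrow> z \<in> Q \<Longrightarrow> u \<in> Q \<Longrightarrow> ?F x z u z = \<mu> * of_bool (x = u)"
    using invariant_cocycle_diagonal[OF F inv] by blast
  obtain a where a: "\<And>z. z \<in> Q \<Longrightarrow> a z z = 0"
    "\<And>z w x u. z \<in> Q \<Longrightarrow> w \<in> Q \<Longrightarrow> z \<noteq> w \<Longrightarrow> x \<in> Q \<Longrightarrow> u \<in> Q \<Longrightarrow>
      ?F x z u w = a z w * (of_bool (x \<triangleleft> z = u \<triangleleft> w) - of_bool (x = u))"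
    "\<And>g z w. g \<in> carrier G \<Longrightarrow> z \<in> Q \<Longrightarrow> w \<in> Q \<Longrightarrow> a (z \<triangleleft> g) (w \<triangleleft> g) = a z w"
    using invariant_cocycle_off_diagonal[OF F inv] by blast
  have avg: "?F x y u v = \<mu> * of_bool (x = u \<and> y = v) + coboundary a x y u v"
    if "x \<in> Q" "y \<in> Q" "u \<in> Q" "v \<in> Q" for x y u v
    using that \<mu>[of x v u] a(1)[of v] a(2)[of y v x u] a(3)[of v x u]
    by (cases "y = v") (simp_all add: coboundary_def Q_sub)
  obtain b where b: "\<And>x y u v. x \<in> Q \<Longrightarrow> y \<in> Q \<Longrightarrow> u \<in> Q \<Longrightarrow> v \<in> Q \<Longrightarrow>
      f x y u v = ?F x y u v + coboundary b x y u v"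
    using average_homotopic[OF f] by metis
  show ?thesis
  proof (intro exI ballI)
    fix x y u v assume "x \<in> Q" "y \<in> Q" "u \<in> Q" "v \<in> Q"
    then show "f x y u v = \<mu> * of_bool (x = u \<and> y = v) + coboundary (\<lambda>x u. a x u + b x u) x y u v"
      using b avg coboundary_add[of a x y u v b] by simp
  qed
qed



end

section \<open>Intertwiners modulo powers of the variable\<close>

definition agree :: "nat \<Rightarrow> 'k::comm_ring_1 fps \<Rightarrow> 'k fps \<Rightarrow> bool" where
  "agree n a b \<longleftrightarrow> (\<forall>i<n. a $ i = b $ i)"

lemma agree_refl [simp]: "agree n a a"
  and agree_sym: "agree n a b \<Longrightarrow> agree n b a"
  and agree_trans: "agree n a b \<Longrightarrow> agree n b c \<Longrightarrow> agree n a c"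
  by (auto simp: agree_def)

lemma agree_mult: "agree n a b \<Longrightarrow> agree n c d \<Longrightarrow> agree n (a * c) (b * d)"
  by (auto simp: agree_def fps_mult_nth intro!: sum.cong)

lemma agree_sum: "(\<And>i. i \<in> I \<Longrightarrow> agree n (f i) (g i)) \<Longrightarrow> agree n (sum f I) (sum g I)"
  by (auto simp: agree_def fps_sum_nth intro!: sum.cong)

lemma agree_decomp: "agree n a b \<Longrightarrow> a = b + fps_X ^ n * fps_shift n (a - b)"
  by (rule fps_ext) (auto simp: agree_def fps_X_power_mult_nth)

lemma agree_Suc: "c $ 0 = 0 \<Longrightarrow> agree (Suc n) (b + fps_X ^ n * c) b"
  by (auto simp: agree_def fps_X_power_mult_nth less_Suc_eq)

context centreless_class begin

text \<open>Elements of \<open>V \<otimes> V \<otimes> V\<close> are represented by their coefficient functions \<open>t\<close>, and operators on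
  \<open>V \<otimes> V\<close> by matrices \<open>m\<close>, where \<open>m p q u v\<close> is the coefficient of \<open>u \<otimes> v\<close> in the image of
  \<open>p \<otimes> q\<close>. The functions below apply \<open>m\<close> to the first two and to the last two tensor factors. Only
  arguments in \<open>Q\<close> are meaningful.\<close>

definition act12 :: "('a \<Rightarrow> 'a \<Rightarrow> 'a \<Rightarrow> 'a \<Rightarrow> 'r::comm_ring_1) \<Rightarrow> ('a \<Rightarrow> 'a \<Rightarrow> 'a \<Rightarrow> 'r) \<Rightarrow> 'a \<Rightarrow> 'a \<Rightarrow> 'a \<Rightarrow> 'r" where
  "act12 m t u v w = (\<Sum>p\<in>Q. \<Sum>q\<in>Q. t p q w * m p q u v)"

definition act23 :: "('a \<Rightarrow> 'a \<Rightarrow> 'a \<Rightarrow> 'a \<Rightarrow> 'r::comm_ring_1) \<Rightarrow> ('a \<Rightarrow> 'a \<Rightarrow> 'a \<Rightarrow> 'r) \<Rightarrow> 'a \<Rightarrow> 'a \<Rightarrow> 'a \<Rightarrow> 'r" where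
  "act23 m t u v w = (\<Sum>q\<in>Q. \<Sum>r\<in>Q. t u q r * m q r v w)"

definition yang_baxter :: "('a \<Rightarrow> 'a \<Rightarrow> 'a \<Rightarrow> 'a \<Rightarrow> 'r::comm_ring_1) \<Rightarrow> bool" where
  "yang_baxter m \<longleftrightarrow> (\<forall>t. \<forall>u\<in>Q. \<forall>v\<in>Q. \<forall>w\<in>Q.
     act12 m (act23 m (act12 m t)) u v w = act23 m (act12 m (act23 m t)) u v w)"

lemma act12_linear:
  "act12 m (\<lambda>u v w. a * t u v w + b * t' u v w) u v w = a * act12 m t u v w + b * act12 m t' u v w"
  by (simp add: act12_def sum_distrib_left sum.distrib[symmetric] algebra_simps)

lemma act23_linear:
  "act23 m (\<lambda>u v w. a * t u v w + b * t' u v w) u v w = a * act23 m t u v w + b * act23 m t' u v w"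
  by (simp add: act23_def sum_distrib_left sum.distrib[symmetric] algebra_simps)

lemma act12_cong:
  "w \<in> Q \<Longrightarrow> (\<And>u v w. u \<in> Q \<Longrightarrow> v \<in> Q \<Longrightarrow> w \<in> Q \<Longrightarrow> t u v w = t' u v w) \<Longrightarrow>
    act12 m t u v w = act12 m t' u v w"
  by (simp add: act12_def cong: sum.cong)

lemma act23_cong:
  "u \<in> Q \<Longrightarrow> (\<And>u v w. u \<in> Q \<Longrightarrow> v \<in> Q \<Longrightarrow> w \<in> Q \<Longrightarrow> t u v w = t' u v w) \<Longrightarrow>
    act23 m t u v w = act23 m t' u v w"
  by (simp add: act23_def cong: sum.cong)

definition rack_matrix :: "'a \<Rightarrow> 'a \<Rightarrow> 'a \<Rightarrow> 'a \<Rightarrow> 'r::comm_ring_1" where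
  "rack_matrix x y u v = of_bool (u = y \<and> v = x \<triangleleft> y)"

text \<open>The rack matrix permutes the basis, so a coefficient of the image is read off at the image of a
  basis vector.\<close>

lemma act12_rack:
  assumes m: "\<And>x y u v. x \<in> Q \<Longrightarrow> y \<in> Q \<Longrightarrow> u \<in> Q \<Longrightarrow> v \<in> Q \<Longrightarrow> m x y u v = c * rack_matrix x y u v"
    and q: "p \<in> Q" "q \<in> Q"
  shows "act12 m t q (p \<triangleleft> q) w = c * t p q w"
proof -
  have "act12 m t q (p \<triangleleft> q) w =
      (\<Sum>p'\<in>Q. \<Sum>q'\<in>Q. if q' = q then if p' = p then c * t p q w else 0 else 0)"
    unfolding act12_def
    using q by (intro sum.cong refl) (auto simp: m rack_matrix_def Q_sub)
  then show ?thesis using q by simp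
qed

lemma act23_rack:
  assumes m: "\<And>x y u v. x \<in> Q \<Longrightarrow> y \<in> Q \<Longrightarrow> u \<in> Q \<Longrightarrow> v \<in> Q \<Longrightarrow> m x y u v = c * rack_matrix x y u v"
    and q: "q \<in> Q" "r \<in> Q"
  shows "act23 m t u r (q \<triangleleft> r) = c * t u q r"
proof -
  have "act23 m t u r (q \<triangleleft> r) =
      (\<Sum>q'\<in>Q. \<Sum>r'\<in>Q. if r' = r then if q' = q then c * t u q r else 0 else 0)"
    unfolding act23_def
    using q by (intro sum.cong refl) (auto simp: m rack_matrix_def Q_sub)
  then show ?thesis using q by simp
qed

text \<open>The output \<open>w \<otimes> v \<triangleleft> w \<otimes> u \<triangleleft> v \<triangleleft> w\<close> is the image of \<open>u \<otimes> v \<otimes> w\<close> under both sides up to the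
  factor \<open>c\<^sup>3\<close>, by self-distributivity.\<close>

lemma yang_baxter_rack:
  assumes m: "\<And>x y u v. x \<in> Q \<Longrightarrow> y \<in> Q \<Longrightarrow> u \<in> Q \<Longrightarrow> v \<in> Q \<Longrightarrow> m x y u v = c * rack_matrix x y u v"
  shows "yang_baxter m"
  unfolding yang_baxter_def
proof (intro allI ballI)
  fix t u' v' w' assume q': "u' \<in> Q" "v' \<in> Q" "w' \<in> Q"
  define w where "w = u'"
  define v where "v = v' \<triangleleft> inv w"
  define u where "u = w' \<triangleleft> inv w \<triangleleft> inv v"
  have q: "u \<in> Q" "v \<in> Q" "w \<in> Q" and e: "u' = w" "v' = v \<triangleleft> w" "w' = u \<triangleleft> v \<triangleleft> w"
    using q' by (auto simp: u_def v_def w_def Q_sub)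
  have vw: "u \<triangleleft> v \<triangleleft> w = (u \<triangleleft> w) \<triangleleft> (v \<triangleleft> w)" using q by (simp add: conj_conj Q_sub)
  note rules = act12_rack[of m, OF m] act23_rack[of m, OF m]
  have "act12 m (act23 m (act12 m t)) w (v \<triangleleft> w) (u \<triangleleft> v \<triangleleft> w) = c * (c * (c * t u v w))"
    using q by (simp add: rules Q_sub)
  moreover have "act23 m (act12 m (act23 m t)) w (v \<triangleleft> w) (u \<triangleleft> w \<triangleleft> (v \<triangleleft> w)) = c * (c * (c * t u v w))"
    using q by (simp add: rules Q_sub)
  ultimately show "act12 m (act23 m (act12 m t)) u' v' w' = act23 m (act12 m (act23 m t)) u' v' w'"
    by (simp add: e vw)
qed

definition deforms :: "('a \<Rightarrow> 'a \<Rightarrow> 'a \<Rightarrow> 'a \<Rightarrow> 'k::field_char_0 fps) \<Rightarrow> bool" where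
  "deforms m \<longleftrightarrow> (\<forall>x\<in>Q. \<forall>y\<in>Q. \<forall>u\<in>Q. \<forall>v\<in>Q. m x y u v $ 0 = rack_matrix x y u v)"

lemma act12_leading:
  assumes m: "deforms m" and q: "p \<in> Q" "q \<in> Q"
  shows "act12 m t q (p \<triangleleft> q) w $ 0 = t p q w $ 0"
proof -
  have "act12 m t q (p \<triangleleft> q) w $ 0 = act12 (\<lambda>x y u v. m x y u v $ 0) (\<lambda>u v w. t u v w $ 0) q (p \<triangleleft> q) w"
    by (simp add: act12_def fps_sum_nth)
  also have "\<dots> = 1 * t p q w $ 0"
    by (rule act12_rack) (use m q in \<open>simp_all add: deforms_def\<close>)
  finally show ?thesis by simp
qed

lemma act23_leading:
  assumes m: "deforms m" and q: "q \<in> Q" "r \<in> Q"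
  shows "act23 m t u r (q \<triangleleft> r) $ 0 = t u q r $ 0"
proof -
  have "act23 m t u r (q \<triangleleft> r) $ 0 = act23 (\<lambda>x y u v. m x y u v $ 0) (\<lambda>u v w. t u v w $ 0) u r (q \<triangleleft> r)"
    by (simp add: act23_def fps_sum_nth)
  also have "\<dots> = 1 * t u q r $ 0"
    by (rule act23_rack) (use m q in \<open>simp_all add: deforms_def\<close>)
  finally show ?thesis by simp
qed

text \<open>The coefficients of \<open>c (\<alpha> x \<otimes> \<alpha> y)\<close>, where \<open>\<alpha> x k\<close> is the coefficient of \<open>k\<close> in \<open>\<alpha> x\<close>.\<close>

definition twisted :: "('a \<Rightarrow> 'a \<Rightarrow> 'a \<Rightarrow> 'a \<Rightarrow> 'r::comm_ring_1) \<Rightarrow> ('a \<Rightarrow> 'a \<Rightarrow> 'r) \<Rightarrow> 'a \<Rightarrow> 'a \<Rightarrow> 'a \<Rightarrow> 'a \<Rightarrow> 'r" where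
  "twisted m \<alpha> x y u v = (\<Sum>k\<in>Q. \<Sum>l\<in>Q. \<alpha> x k * \<alpha> y l * m k l u v)"

text \<open>The equation \<open>c (\<alpha> \<otimes> \<alpha>) = s (\<alpha> \<otimes> \<alpha>) c\<^sub>Q\<close> modulo \<open>h\<^sup>n\<close>. Stated in this way, it needs no inverse
  of \<open>\<alpha>\<close>.\<close>

definition intertwines :: "nat \<Rightarrow> ('a \<Rightarrow> 'a \<Rightarrow> 'a \<Rightarrow> 'a \<Rightarrow> 'k::comm_ring_1 fps) \<Rightarrow> ('a \<Rightarrow> 'a \<Rightarrow> 'k fps) \<Rightarrow> 'k fps \<Rightarrow> bool" where
  "intertwines n m \<alpha> s \<longleftrightarrow> (\<forall>x\<in>Q. \<forall>y\<in>Q. \<forall>u\<in>Q. \<forall>v\<in>Q.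
     agree n (twisted m \<alpha> x y u v) (s * (\<alpha> y u * \<alpha> (x \<triangleleft> y) v)))"

definition near_identity :: "('a \<Rightarrow> 'a \<Rightarrow> 'k::comm_ring_1 fps) \<Rightarrow> bool" where
  "near_identity \<alpha> \<longleftrightarrow> (\<forall>x\<in>Q. \<forall>u\<in>Q. \<alpha> x u $ 0 = of_bool (x = u))"

text \<open>Both sides of the Yang-Baxter equation are applied to \<open>\<alpha> x \<otimes> \<alpha> y \<otimes> \<alpha> z\<close>. Each factor \<open>c\<close> moves
  this tensor to another one of the same form and leaves an error, to which the remaining factors
  are applied. The main terms agree, and the errors can be divided by \<open>e\<close>, without reducing modulo
  anything.\<close>

lemma yang_baxter_error_equation:
  fixes m :: "'a \<Rightarrow> 'a \<Rightarrow> 'a \<Rightarrow> 'a \<Rightarrow> 'r::idom"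
  assumes yb: "yang_baxter m" and e: "e \<noteq> 0"
    and R: "\<And>x y u v. x \<in> Q \<Longrightarrow> y \<in> Q \<Longrightarrow> u \<in> Q \<Longrightarrow> v \<in> Q \<Longrightarrow>
      twisted m \<alpha> x y u v = s * (\<alpha> y u * \<alpha> (x \<triangleleft> y) v) + e * D x y u v"
    and q: "x \<in> Q" "y \<in> Q" "z \<in> Q" "u \<in> Q" "v \<in> Q" "w \<in> Q"
  shows "s\<^sup>2 * (D y z u v * \<alpha> (x \<triangleleft> y \<triangleleft> z) w)
      + s * act12 m (\<lambda>u v w. \<alpha> y u * D (x \<triangleleft> y) z v w) u v w
      + act12 m (act23 m (\<lambda>u v w. D x y u v * \<alpha> z w)) u v w
    = s\<^sup>2 * (\<alpha> z u * D (x \<triangleleft> z) (y \<triangleleft> z) v w)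
      + s * act23 m (\<lambda>u v w. D x z u v * \<alpha> (y \<triangleleft> z) w) u v w
      + act23 m (act12 m (\<lambda>u v w. \<alpha> x u * D y z v w)) u v w"
proof -
  define T where "T x y z u v w = \<alpha> x u * \<alpha> y v * \<alpha> z w" for x y z u v w
  have T12: "act12 m (T x y z) u v w = s * T y (x \<triangleleft> y) z u v w + e * (D x y u v * \<alpha> z w)"
    if "x \<in> Q" "y \<in> Q" "z \<in> Q" "u \<in> Q" "v \<in> Q" "w \<in> Q" for x y z u v w
  proof -
    have "act12 m (T x y z) u v w = twisted m \<alpha> x y u v * \<alpha> z w"
      by (simp add: act12_def twisted_def T_def sum_distrib_left sum_distrib_right mult_ac)
    then show ?thesis using R that by (simp add: T_def algebra_simps)
  qed
  have T23: "act23 m (T x y z) u v w = s * T x z (y \<triangleleft> z) u v w + e * (\<alpha> x u * D y z v w)"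
    if "x \<in> Q" "y \<in> Q" "z \<in> Q" "u \<in> Q" "v \<in> Q" "w \<in> Q" for x y z u v w
  proof -
    have "act23 m (T x y z) u v w = \<alpha> x u * twisted m \<alpha> y z v w"
      by (simp add: act23_def twisted_def T_def sum_distrib_left sum_distrib_right mult_ac)
    then show ?thesis using R that by (simp add: T_def algebra_simps)
  qed
  note cl = Q_conj Q_sub
  have L1: "act23 m (act12 m (T x y z)) u v w =
      s * (s * T y z (x \<triangleleft> y \<triangleleft> z) u v w + e * (\<alpha> y u * D (x \<triangleleft> y) z v w))
      + e * act23 m (\<lambda>u v w. D x y u v * \<alpha> z w) u v w"
    if "u \<in> Q" "v \<in> Q" "w \<in> Q" for u v w
  proof -
    have "act23 m (act12 m (T x y z)) u v w =
        act23 m (\<lambda>u v w. s * T y (x \<triangleleft> y) z u v w + e * (D x y u v * \<alpha> z w)) u v w"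
      by (rule act23_cong) (use that q in \<open>simp_all add: T12\<close>)
    then show ?thesis using that q by (simp add: act23_linear T23 cl)
  qed
  have L: "act12 m (act23 m (act12 m (T x y z))) u v w =
      s * (s * (s * T z (y \<triangleleft> z) (x \<triangleleft> y \<triangleleft> z) u v w + e * (D y z u v * \<alpha> (x \<triangleleft> y \<triangleleft> z) w))
           + e * act12 m (\<lambda>u v w. \<alpha> y u * D (x \<triangleleft> y) z v w) u v w)
      + e * act12 m (act23 m (\<lambda>u v w. D x y u v * \<alpha> z w)) u v w"
  proof -
    have "act12 m (act23 m (act12 m (T x y z))) u v w =
      act12 m (\<lambda>u v w. s * (s * T y z (x \<triangleleft> y \<triangleleft> z) u v w + e * (\<alpha> y u * D (x \<triangleleft> y) z v w))
      + e * act23 m (\<lambda>u v w. D x y u v * \<alpha> z w) u v w) u v w"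
      by (rule act12_cong) (use q in \<open>simp_all add: L1\<close>)
    then show ?thesis using q by (simp add: act12_linear T12 cl)
  qed
  have R1: "act12 m (act23 m (T x y z)) u v w =
      s * (s * T z (x \<triangleleft> z) (y \<triangleleft> z) u v w + e * (D x z u v * \<alpha> (y \<triangleleft> z) w))
      + e * act12 m (\<lambda>u v w. \<alpha> x u * D y z v w) u v w"
    if "u \<in> Q" "v \<in> Q" "w \<in> Q" for u v w
  proof -
    have "act12 m (act23 m (T x y z)) u v w =
        act12 m (\<lambda>u v w. s * T x z (y \<triangleleft> z) u v w + e * (\<alpha> x u * D y z v w)) u v w"
      by (rule act12_cong) (use that q in \<open>simp_all add: T23\<close>)
    then show ?thesis using that q by (simp add: act12_linear T12 cl)
  qed
  have R: "act23 m (act12 m (act23 m (T x y z))) u v w =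
      s * (s * (s * T z (y \<triangleleft> z) (x \<triangleleft> y \<triangleleft> z) u v w + e * (\<alpha> z u * D (x \<triangleleft> z) (y \<triangleleft> z) v w))
           + e * act23 m (\<lambda>u v w. D x z u v * \<alpha> (y \<triangleleft> z) w) u v w)
      + e * act23 m (act12 m (\<lambda>u v w. \<alpha> x u * D y z v w)) u v w"
  proof -
    have "act23 m (act12 m (act23 m (T x y z))) u v w =
      act23 m (\<lambda>u v w. s * (s * T z (x \<triangleleft> z) (y \<triangleleft> z) u v w + e * (D x z u v * \<alpha> (y \<triangleleft> z) w))
      + e * act12 m (\<lambda>u v w. \<alpha> x u * D y z v w) u v w) u v w"
      by (rule act23_cong) (use q in \<open>simp_all add: R1\<close>)
    then show ?thesis using q by (simp add: act23_linear T23 cl conj_conj)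
  qed
  have "act12 m (act23 m (act12 m (T x y z))) u v w = act23 m (act12 m (act23 m (T x y z))) u v w"
    using yb q unfolding yang_baxter_def by blast
  then have "e * (s\<^sup>2 * (D y z u v * \<alpha> (x \<triangleleft> y \<triangleleft> z) w)
      + s * act12 m (\<lambda>u v w. \<alpha> y u * D (x \<triangleleft> y) z v w) u v w
      + act12 m (act23 m (\<lambda>u v w. D x y u v * \<alpha> z w)) u v w)
    = e * (s\<^sup>2 * (\<alpha> z u * D (x \<triangleleft> z) (y \<triangleleft> z) v w)
      + s * act23 m (\<lambda>u v w. D x z u v * \<alpha> (y \<triangleleft> z) w) u v w
      + act23 m (act12 m (\<lambda>u v w. \<alpha> x u * D y z v w)) u v w)"
    unfolding L R by (simp add: algebra_simps power2_eq_square)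
  then show ?thesis using e by simp
qed

text \<open>At order 0 the operator is \<open>c\<^sub>Q\<close> and \<open>\<alpha>\<close> is the identity, so the error equation becomes the cocycle
  equation once it is read at the output \<open>w \<otimes> v \<triangleleft> w \<otimes> u \<triangleleft> v \<triangleleft> w\<close>, the image of \<open>u \<otimes> v \<otimes> w\<close> under
  \<open>c\<^sub>1 c\<^sub>2 c\<^sub>1\<close>. The substitution \<open>D x y v (u \<triangleleft> v)\<close> turns \<open>D\<close> into \<open>c\<^sub>Q\<^bsup>-1\<^esup> D\<close> in the same way.\<close>

lemma leading_error_cocycle:
  fixes m :: "'a \<Rightarrow> 'a \<Rightarrow> 'a \<Rightarrow> 'a \<Rightarrow> 'k::field_char_0 fps"
  assumes yb: "yang_baxter m" and m: "deforms m"
    and \<alpha>: "near_identity \<alpha>" and s: "s $ 0 = 1"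
    and R: "\<And>x y u v. x \<in> Q \<Longrightarrow> y \<in> Q \<Longrightarrow> u \<in> Q \<Longrightarrow> v \<in> Q \<Longrightarrow>
      twisted m \<alpha> x y u v = s * (\<alpha> y u * \<alpha> (x \<triangleleft> y) v) + fps_X ^ n * D x y u v"
  shows "cocycle (\<lambda>x y u v. D x y v (u \<triangleleft> v) $ 0)"
  unfolding cocycle_def
proof (intro ballI)
  fix x y z u v w assume q: "x \<in> Q" "y \<in> Q" "z \<in> Q" "u \<in> Q" "v \<in> Q" "w \<in> Q"
  have vw: "u \<triangleleft> v \<triangleleft> w = (u \<triangleleft> w) \<triangleleft> (v \<triangleleft> w)" using q by (simp add: conj_conj Q_sub)
  have X: "(fps_X :: 'k fps) ^ n \<noteq> 0" by simp
  note E = arg_cong[OF yang_baxter_error_equation[OF yb X R q(1-3), of w "v \<triangleleft> w" "u \<triangleleft> v \<triangleleft> w"],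
      of "\<lambda>a. a $ 0"]
  have al: "\<alpha> p r $ 0 = of_bool (p = r)" if "p \<in> Q" "r \<in> Q" for p r
    using \<alpha> that by (auto simp: near_identity_def)
  have "act12 m t w (v \<triangleleft> w) (u \<triangleleft> v \<triangleleft> w) $ 0 = t v w (u \<triangleleft> v \<triangleleft> w) $ 0" for t
    using q by (simp add: act12_leading[OF m])
  moreover have "act23 m t w (v \<triangleleft> w) (u \<triangleleft> v \<triangleleft> w) $ 0 = t w (u \<triangleleft> w) (v \<triangleleft> w) $ 0" for t
    unfolding vw using q by (simp add: act23_leading[OF m] Q_sub)
  moreover have "act23 m t v w (u \<triangleleft> v \<triangleleft> w) $ 0 = t v (u \<triangleleft> v) w $ 0" for t
    using q by (simp add: act23_leading[OF m] Q_sub)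
  moreover have "act12 m t w (u \<triangleleft> w) (v \<triangleleft> w) $ 0 = t u w (v \<triangleleft> w) $ 0" for t
    using q by (simp add: act12_leading[OF m] Q_sub)
  ultimately show "D y z w (v \<triangleleft> w) $ 0 * (of_bool (x \<triangleleft> y \<triangleleft> z = u \<triangleleft> v \<triangleleft> w) - of_bool (x = u))
     + D (x \<triangleleft> y) z w (u \<triangleleft> v \<triangleleft> w) $ 0 * of_bool (y = v)
     - D x z w (u \<triangleleft> w) $ 0 * of_bool (y \<triangleleft> z = v \<triangleleft> w)
     + (D x y v (u \<triangleleft> v) $ 0 - D (x \<triangleleft> z) (y \<triangleleft> z) (v \<triangleleft> w) (u \<triangleleft> w \<triangleleft> (v \<triangleleft> w)) $ 0) * of_bool (z = w) = 0"
    using E q s by (simp add: al Q_sub vw[symmetric] fps_power_zeroth algebra_simps)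
qed

text \<open>The cocycle of the error is \<open>\<mu>\<close> times the identity plus the coboundary of \<open>a\<close>, and the corrections
  \<open>h\<^sup>n a\<close> of \<open>\<alpha>\<close> and \<open>h\<^sup>n \<mu>\<close> of \<open>s\<close> cancel it. As \<open>n > 0\<close>, terms of order \<open>h\<^bsup>2n\<^esup>\<close> do not matter.\<close>

lemma improve_intertwiner:
  fixes m :: "'a \<Rightarrow> 'a \<Rightarrow> 'a \<Rightarrow> 'a \<Rightarrow> 'k::field_char_0 fps"
  assumes yb: "yang_baxter m" and m: "deforms m"
    and \<alpha>: "near_identity \<alpha>" and s: "s $ 0 = 1" and n: "n > 0" and R: "intertwines n m \<alpha> s"
  shows "\<exists>\<alpha>' s'. near_identity \<alpha>' \<and> s' $ 0 = 1 \<and> intertwines (Suc n) m \<alpha>' s' \<and>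
    (\<forall>x u. agree n (\<alpha>' x u) (\<alpha> x u)) \<and> agree n s' s"
proof -
  let ?e = "fps_X ^ n :: 'k fps"
  define D where "D x y u v = fps_shift n (twisted m \<alpha> x y u v - s * (\<alpha> y u * \<alpha> (x \<triangleleft> y) v))" for x y u v
  have D: "twisted m \<alpha> x y u v = s * (\<alpha> y u * \<alpha> (x \<triangleleft> y) v) + ?e * D x y u v"
    if "x \<in> Q" "y \<in> Q" "u \<in> Q" "v \<in> Q" for x y u v
    unfolding D_def by (rule agree_decomp) (use R that in \<open>simp add: intertwines_def\<close>)
  obtain \<mu> a where f: "\<And>x y u v. x \<in> Q \<Longrightarrow> y \<in> Q \<Longrightarrow> u \<in> Q \<Longrightarrow> v \<in> Q \<Longrightarrow>
      D x y v (u \<triangleleft> v) $ 0 = \<mu> * of_bool (x = u \<and> y = v) + coboundary a x y u v"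
    using cocycle_trivial[OF leading_error_cocycle[OF yb m \<alpha> s D]] by blast
  define A where "A x u = fps_const (a x u)" for x u
  define \<alpha>' where "\<alpha>' x u = \<alpha> x u + ?e * A x u" for x u
  define s' where "s' = s + ?e * fps_const \<mu>"
  have e0: "?e $ 0 = 0" using n by simp
  have al: "\<alpha> p r $ 0 = of_bool (p = r)" if "p \<in> Q" "r \<in> Q" for p r
    using \<alpha> that by (auto simp: near_identity_def)
  have "agree (Suc n) (twisted m \<alpha>' x y v (u \<triangleleft> v)) (s' * (\<alpha>' y v * \<alpha>' (x \<triangleleft> y) (u \<triangleleft> v)))"
    if q: "x \<in> Q" "y \<in> Q" "u \<in> Q" "v \<in> Q" for x y u v
  proof -
    define S where "S = (\<Sum>k\<in>Q. \<Sum>l\<in>Q. (A x k * \<alpha> y l + \<alpha> x k * A y l) * m k l v (u \<triangleleft> v))"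
    \<comment> \<open>\<open>h\<^sup>n B\<close> is the new error, written at the output \<open>c\<^sub>Q (u \<otimes> v) = v \<otimes> u \<triangleleft> v\<close> in order to compare it with the cocycle\<close>
    define B where "B = D x y v (u \<triangleleft> v) + S + ?e * twisted m A x y v (u \<triangleleft> v)
      - fps_const \<mu> * (\<alpha>' y v * \<alpha>' (x \<triangleleft> y) (u \<triangleleft> v))
      - s * (A y v * \<alpha> (x \<triangleleft> y) (u \<triangleleft> v) + \<alpha> y v * A (x \<triangleleft> y) (u \<triangleleft> v) + ?e * A y v * A (x \<triangleleft> y) (u \<triangleleft> v))"
    have "twisted m \<alpha>' x y v (u \<triangleleft> v) =
        twisted m \<alpha> x y v (u \<triangleleft> v) + ?e * (S + ?e * twisted m A x y v (u \<triangleleft> v))"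
      by (simp add: twisted_def \<alpha>'_def S_def sum_distrib_left sum.distrib[symmetric] algebra_simps)
    then have "twisted m \<alpha>' x y v (u \<triangleleft> v) = s' * (\<alpha>' y v * \<alpha>' (x \<triangleleft> y) (u \<triangleleft> v)) + ?e * B"
      using q by (simp add: D Q_sub B_def s'_def \<alpha>'_def algebra_simps)
    moreover have "B $ 0 = 0"
    proof -
      have "S $ 0 = (\<Sum>k\<in>Q. \<Sum>l\<in>Q.
          if l = v then if k = u then a x k * of_bool (y = l) + of_bool (x = k) * a y l else 0 else 0)"
        unfolding S_def fps_sum_nth fps_mult_nth_0
        using m q by (intro sum.cong refl) (auto simp: deforms_def rack_matrix_def al Q_sub A_def)
      also have "\<dots> = a x u * of_bool (y = v) + of_bool (x = u) * a y v" using q by simp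
      finally show ?thesis using q s e0 f[OF q]
        by (auto simp: B_def al Q_sub \<alpha>'_def A_def coboundary_def)
    qed
    ultimately show ?thesis using agree_Suc by simp
  qed
  then have "intertwines (Suc n) m \<alpha>' s'"
    unfolding intertwines_def by (metis conj_inv_cancel(2) Q_conj Q_sub inv_closed)
  moreover have "near_identity \<alpha>'" "s' $ 0 = 1"
    using \<alpha> s e0 by (auto simp: near_identity_def \<alpha>'_def s'_def)
  moreover have "agree n (\<alpha>' x u) (\<alpha> x u)" "agree n s' s" for x u
    by (auto simp: agree_def \<alpha>'_def s'_def fps_X_power_mult_nth)
  ultimately show ?thesis by blast
qed


lemma intertwines_cong:
  assumes "\<And>x u. agree n (\<alpha>' x u) (\<alpha> x u)" "agree n s' s" "intertwines n m \<alpha> s"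
  shows "intertwines n m \<alpha>' s'"
  unfolding intertwines_def
proof (intro ballI)
  fix x y u v assume q: "x \<in> Q" "y \<in> Q" "u \<in> Q" "v \<in> Q"
  have "agree n (twisted m \<alpha>' x y u v) (twisted m \<alpha> x y u v)"
    unfolding twisted_def by (intro agree_sum agree_mult assms agree_refl)
  moreover have "agree n (twisted m \<alpha> x y u v) (s * (\<alpha> y u * \<alpha> (x \<triangleleft> y) v))"
    using assms(3) q by (simp add: intertwines_def)
  moreover have "agree n (s * (\<alpha> y u * \<alpha> (x \<triangleleft> y) v)) (s' * (\<alpha>' y u * \<alpha>' (x \<triangleleft> y) v))"
    by (intro agree_mult agree_sym[OF assms(1)] agree_sym[OF assms(2)])
  ultimately show "agree n (twisted m \<alpha>' x y u v) (s' * (\<alpha>' y u * \<alpha>' (x \<triangleleft> y) v))"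
    using agree_trans by blast
qed

text \<open>Dependent choice gives a sequence of approximate intertwiners of which each agrees with its
  predecessor up to the order already reached, so the diagonal coefficients define the limit.\<close>

lemma intertwiner_exists:
  fixes m :: "'a \<Rightarrow> 'a \<Rightarrow> 'a \<Rightarrow> 'a \<Rightarrow> 'k::field_char_0 fps"
  assumes yb: "yang_baxter m" and m: "deforms m"
  shows "\<exists>\<alpha> s. near_identity \<alpha> \<and> s $ 0 = 1 \<and>
    (\<forall>x\<in>Q. \<forall>y\<in>Q. \<forall>u\<in>Q. \<forall>v\<in>Q. twisted m \<alpha> x y u v = s * (\<alpha> y u * \<alpha> (x \<triangleleft> y) v))"
proof -
  define P where "P n p \<longleftrightarrow> near_identity (fst p) \<and> snd p $ 0 = 1 \<and> intertwines (Suc n) m (fst p) (snd p)"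
    for n and p :: "('a \<Rightarrow> 'a \<Rightarrow> 'k fps) \<times> 'k fps"
  define R where "R n p p' \<longleftrightarrow> (\<forall>x u. agree (Suc n) (fst p' x u) (fst p x u)) \<and> agree (Suc n) (snd p') (snd p)"
    for n and p p' :: "('a \<Rightarrow> 'a \<Rightarrow> 'k fps) \<times> 'k fps"
  \<comment> \<open>stage \<open>n\<close> is an intertwiner modulo \<open>h\<^bsup>n+1\<^esup>\<close>, so stage 0 is the congruence of \<open>c\<close> and \<open>c\<^sub>Q\<close>\<close>
  have base: "P 0 (\<lambda>x u. of_bool (x = u), 1)"
  proof -
    have "twisted m (\<lambda>x u. of_bool (x = u)) x y u v $ 0 = (of_bool (y = u) * of_bool (x \<triangleleft> y = v))"
      if q: "x \<in> Q" "y \<in> Q" "u \<in> Q" "v \<in> Q" for x y u v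
    proof -
      have "twisted m (\<lambda>x u. of_bool (x = u)) x y u v =
          (\<Sum>k\<in>Q. \<Sum>l\<in>Q. if y = l then if x = k then m k l u v else 0 else 0)"
        unfolding twisted_def by (intro sum.cong refl) auto
      then show ?thesis using q m by (auto simp: deforms_def rack_matrix_def)
    qed
    then show ?thesis
      by (auto simp: P_def near_identity_def intertwines_def agree_def of_bool_def)
  qed
  have step: "\<exists>p'. P (Suc n) p' \<and> R n p p'" if "P n p" for n p
  proof -
    obtain \<alpha> s where "near_identity \<alpha>" "s $ 0 = 1" "intertwines (Suc (Suc n)) m \<alpha> s"
      "\<forall>x u. agree (Suc n) (\<alpha> x u) (fst p x u)" "agree (Suc n) s (snd p)"
      using improve_intertwiner[OF yb m, of "fst p" "snd p" "Suc n"] \<open>P n p\<close>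
      unfolding P_def by blast
    then show ?thesis by (intro exI[of _ "(\<alpha>, s)"]) (simp add: P_def R_def)
  qed
  have "\<exists>F. \<forall>n. P n (F n) \<and> R n (F n) (F (Suc n))"
    by (rule dependent_nat_choice) (fact exI[of "P 0", OF base], fact step)
  then obtain F where F: "\<And>n. P n (F n)" "\<And>n. R n (F n) (F (Suc n))" by blast
  define \<alpha> where "\<alpha> x u = Abs_fps (\<lambda>n. fst (F n) x u $ n)" for x u
  define s where "s = Abs_fps (\<lambda>n. snd (F n) $ n)"
  have stable: "fst (F n) x u $ i = fst (F i) x u $ i" "snd (F n) $ i = snd (F i) $ i"
    if "i \<le> n" for n i x u
    using that
  proof (induction n)
    case (Suc n)
    { case 1 show ?case
        using 1 Suc F(2)[of n] by (cases "i = Suc n") (auto simp: R_def agree_def) }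
    { case 2 show ?case
        using 2 Suc F(2)[of n] by (cases "i = Suc n") (auto simp: R_def agree_def) }
  qed simp_all
  have lim: "intertwines (Suc n) m \<alpha> s" for n
    by (rule intertwines_cong[of _ _ "fst (F n)" _ "snd (F n)"])
      (use F(1)[of n] in \<open>auto simp: agree_def \<alpha>_def s_def stable[of _ n] P_def\<close>)
  have "twisted m \<alpha> x y u v = s * (\<alpha> y u * \<alpha> (x \<triangleleft> y) v)"
    if "x \<in> Q" "y \<in> Q" "u \<in> Q" "v \<in> Q" for x y u v
  proof (rule fps_ext)
    fix n show "twisted m \<alpha> x y u v $ n = (s * (\<alpha> y u * \<alpha> (x \<triangleleft> y) v)) $ n"
      using lim[of n] that unfolding intertwines_def agree_def by blast
  qed
  moreover have "near_identity \<alpha>" "s $ 0 = 1"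
    using F(1)[of 0] by (auto simp: P_def near_identity_def \<alpha>_def s_def)
  ultimately show ?thesis by blast
qed

end

section \<open>Linear maps between free modules and their matrices\<close>

lemma lookup_basis: "Poly_Mapping.lookup (basis b) k = of_bool (k = b)"
  by (auto simp: basis_def lookup_single when_def)

lemma lookup_lin_ext:
  assumes "finite B" "u \<in> free_mod B"
  shows "Poly_Mapping.lookup (lin_ext f u) p = (\<Sum>b\<in>B. Poly_Mapping.lookup u b * Poly_Mapping.lookup (f b) p)"
  using assms by (simp add: lin_ext_superset free_mod_def lookup_sum)

lemma lookup_linear_on:
  assumes "linear_on B C f" "finite B" "u \<in> free_mod B"
  shows "Poly_Mapping.lookup (f u) p = (\<Sum>b\<in>B. Poly_Mapping.lookup u b * Poly_Mapping.lookup (f (basis b)) p)"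
  by (subst linear_on_eq_lin_ext[OF assms(1,3)]) (rule lookup_lin_ext[OF assms(2,3)])

lemma linear_on_eqI:
  assumes "linear_on B C f" "linear_on B D g" "\<And>b. b \<in> B \<Longrightarrow> f (basis b) = g (basis b)"
    and u: "u \<in> free_mod B"
  shows "f u = g u"
proof -
  have "lin_ext (\<lambda>b. f (basis b)) u = lin_ext (\<lambda>b. g (basis b)) u"
    unfolding lin_ext_def using assms(3) u by (intro sum.cong) (auto simp: free_mod_def)
  then show ?thesis using linear_on_eq_lin_ext assms(1,2) u by metis
qed

lemma free_mod_eqI:
  assumes "u \<in> free_mod B" "v \<in> free_mod B"
    and "\<And>b. b \<in> B \<Longrightarrow> Poly_Mapping.lookup u b = Poly_Mapping.lookup v b"
  shows "u = v"
  using assms unfolding free_mod_iff by (metis poly_mapping_eqI)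

lemma linear_on_compose: "linear_on B C f \<Longrightarrow> linear_on C D g \<Longrightarrow> linear_on B D (\<lambda>u. g (f u))"
  by (simp add: linear_on_def)

lemma linear_on_id: "linear_on B B (\<lambda>u. u)"
  by (simp add: linear_on_def)

lemma linear_on_scale: "linear_on B C f \<Longrightarrow> linear_on B C (\<lambda>u. a \<cdot>\<^sub>f f u)"
  by (auto simp: linear_on_def fmod.scale_right_distrib mult.commute
      intro!: fmod.subspace_scale free_mod_subspace)

lemma bij_betw_free_modI:
  assumes f: "linear_on B C f" and g: "linear_on C B g"
    and "\<And>b. b \<in> B \<Longrightarrow> g (f (basis b)) = basis b" "\<And>c. c \<in> C \<Longrightarrow> f (g (basis c)) = basis c"
  shows "bij_betw f (free_mod B) (free_mod C)"
proof (rule bij_betw_byWitness[where f' = g])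
  show "\<forall>u\<in>free_mod B. g (f u) = u"
    using linear_on_eqI[OF linear_on_compose[OF f g] linear_on_id] assms(3) by blast
  show "\<forall>u\<in>free_mod C. f (g u) = u"
    using linear_on_eqI[OF linear_on_compose[OF g f] linear_on_id] assms(4) by blast
qed (use f g in \<open>auto simp: linear_on_def\<close>)

lemma lookup_relabel:
  assumes "inj_on \<pi> B" "u \<in> free_mod B" "b \<in> B"
  shows "Poly_Mapping.lookup (lin_ext (\<lambda>b. basis (\<pi> b)) u) (\<pi> b) = Poly_Mapping.lookup u b"
proof -
  have "\<pi> b = \<pi> k \<longleftrightarrow> b = k" if "k \<in> Poly_Mapping.keys u" for k
    using assms that by (auto simp: free_mod_def inj_on_def)
  then have "Poly_Mapping.lookup (lin_ext (\<lambda>b. basis (\<pi> b)) u) (\<pi> b) =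
      (\<Sum>k\<in>Poly_Mapping.keys u. if b = k then Poly_Mapping.lookup u b else 0)"
    unfolding lin_ext_def lookup_sum by (intro sum.cong refl) (auto simp: lookup_basis)
  then show ?thesis by (simp add: in_keys_iff)
qed

lemma lookup_assoc_right:
  "Poly_Mapping.lookup (assoc_right w) (b, (c, d)) = Poly_Mapping.lookup w ((b, c), d)"
  using lookup_relabel[of "\<lambda>((b, c), d). (b, (c, d))" UNIV w "((b, c), d)"]
  by (simp add: assoc_right_def case_prod_unfold inj_on_def free_mod_def prod_eq_iff)

lemma lookup_assoc_left:
  "Poly_Mapping.lookup (assoc_left w) ((b, c), d) = Poly_Mapping.lookup w (b, (c, d))"
  using lookup_relabel[of "\<lambda>(b, (c, d)). ((b, c), d)" UNIV w "(b, (c, d))"]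
  by (simp add: assoc_left_def case_prod_unfold inj_on_def free_mod_def prod_eq_iff)

lemma assoc_left_linear: "linear_on (B \<times> (C \<times> D)) ((B \<times> C) \<times> D) assoc_left"
  unfolding assoc_left_def by (rule lin_ext_linear) auto

lemma assoc_right_linear: "linear_on ((B \<times> C) \<times> D) (B \<times> (C \<times> D)) assoc_right"
  unfolding assoc_right_def by (rule lin_ext_linear) auto

definition op_matrix :: "('q, 'r::comm_ring_1) tensor_op \<Rightarrow> 'q \<Rightarrow> 'q \<Rightarrow> 'q \<Rightarrow> 'q \<Rightarrow> 'r" where
  "op_matrix c x y u v = Poly_Mapping.lookup (c (basis (x, y))) (u, v)"

definition matrix_map :: "'q set \<Rightarrow> ('q \<Rightarrow> 'q \<Rightarrow> 'r::comm_ring_1) \<Rightarrow> ('q \<Rightarrow>\<^sub>0 'r) \<Rightarrow> ('q \<Rightarrow>\<^sub>0 'r)" where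
  "matrix_map Q \<alpha> = lin_ext (\<lambda>x. \<Sum>u\<in>Q. Poly_Mapping.single u (\<alpha> x u))"

lemma lookup_matrix_map_basis:
  "finite Q \<Longrightarrow> Poly_Mapping.lookup (matrix_map Q \<alpha> (basis x)) u = (if u \<in> Q then \<alpha> x u else 0)"
  by (simp add: matrix_map_def lookup_sum lookup_single when_def)

lemma matrix_map_linear: "finite Q \<Longrightarrow> linear_on Q Q (matrix_map Q \<alpha>)"
  unfolding matrix_map_def
  by (rule lin_ext_linear) (auto simp: free_mod_iff lookup_sum lookup_single when_def)

lemma matrix_map_inverse:
  assumes "finite Q" "x \<in> Q"
    and "\<And>x v. x \<in> Q \<Longrightarrow> v \<in> Q \<Longrightarrow> (\<Sum>u\<in>Q. \<alpha> x u * \<beta> u v) = of_bool (x = v)"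
  shows "matrix_map Q \<beta> (matrix_map Q \<alpha> (basis x)) = basis x"
proof (rule poly_mapping_eqI)
  fix k
  have lin: "linear_on Q Q (matrix_map Q \<beta>)" "matrix_map Q \<alpha> (basis x) \<in> free_mod Q"
    using matrix_map_linear[OF assms(1), of \<beta>] matrix_map_linear[OF assms(1), of \<alpha>] assms(2)
    by (simp_all add: linear_on_def)
  show "Poly_Mapping.lookup (matrix_map Q \<beta> (matrix_map Q \<alpha> (basis x))) k = Poly_Mapping.lookup (basis x) k"
    using lookup_linear_on[OF lin(1) assms(1) lin(2), of k] assms
    by (cases "k \<in> Q") (auto simp: lookup_matrix_map_basis lookup_basis cong: sum.cong)
qed

lemma principal_ideal_X: "a \<in> principal_ideal fps_X \<longleftrightarrow> a $ 0 = 0" for a :: "'k::field fps"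
proof
  assume "a $ 0 = 0"
  then have "a = fps_X * fps_shift 1 a" by (intro fps_ext) (auto simp: fps_X_mult_nth)
  then show "a \<in> principal_ideal fps_X" by (metis principal_ideal_def mem_Collect_eq dvd_triv_left)
qed (auto simp: principal_ideal_def)

lemma ideal_mod_X:
  "u \<in> ideal_mod (principal_ideal fps_X) B \<longleftrightarrow> u \<in> free_mod B \<and> (\<forall>b. Poly_Mapping.lookup u b $ 0 = 0)"
  for u :: "'b \<Rightarrow>\<^sub>0 'k::field fps"
  by (subst ideal_mod_iff) (auto simp: principal_ideal_X)

text \<open>The coefficients of the inverse of a matrix \<open>\<alpha>\<close> of power series with constant term \<open>I\<close>, obtained by
  solving \<open>\<alpha> \<beta> = I\<close> for the coefficients of \<open>\<beta>\<close> one after the other.\<close>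

function inverse_coeff :: "'q set \<Rightarrow> ('q \<Rightarrow> 'q \<Rightarrow> 'k::field fps) \<Rightarrow> nat \<Rightarrow> 'q \<Rightarrow> 'q \<Rightarrow> 'k" where
  "inverse_coeff Q \<alpha> n x y = of_bool (n = 0 \<and> x = y) -
     (\<Sum>i<n. \<Sum>u\<in>Q. \<alpha> x u $ (n - i) * inverse_coeff Q \<alpha> i u y)"
  by auto
termination by (relation "measure (\<lambda>(Q, \<alpha>, n, x, y). n)") auto
declare inverse_coeff.simps [simp del]

lemma right_inverse_exists:
  fixes \<alpha> :: "'q \<Rightarrow> 'q \<Rightarrow> 'k::field fps"
  assumes "finite Q" and \<alpha>: "\<And>x u. x \<in> Q \<Longrightarrow> u \<in> Q \<Longrightarrow> \<alpha> x u $ 0 = of_bool (x = u)"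
  shows "\<exists>\<beta>. (\<forall>x u. \<beta> x u $ 0 = of_bool (x = u)) \<and>
    (\<forall>x\<in>Q. \<forall>v\<in>Q. (\<Sum>u\<in>Q. \<alpha> x u * \<beta> u v) = of_bool (x = v))"
proof (intro exI conjI allI ballI)
  define \<beta> where "\<beta> x u = Abs_fps (\<lambda>n. inverse_coeff Q \<alpha> n x u)" for x u
  show "\<beta> x u $ 0 = of_bool (x = u)" for x u
    by (simp add: \<beta>_def inverse_coeff.simps[of _ _ 0])
  fix x v assume q: "x \<in> Q" "v \<in> Q"
  show "(\<Sum>u\<in>Q. \<alpha> x u * \<beta> u v) = of_bool (x = v)"
  proof (rule fps_ext)
    fix n
    have "(\<Sum>u\<in>Q. \<alpha> x u * \<beta> u v) $ n = (\<Sum>u\<in>Q. \<Sum>i\<le>n. \<alpha> x u $ (n - i) * inverse_coeff Q \<alpha> i u v)"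
      unfolding fps_sum_nth fps_mult_nth \<beta>_def
      by (intro sum.cong refl sum.reindex_bij_witness[of _ "\<lambda>i. n - i" "\<lambda>i. n - i"]) auto
    also have "\<dots> = (\<Sum>i\<le>n. \<Sum>u\<in>Q. \<alpha> x u $ (n - i) * inverse_coeff Q \<alpha> i u v)"
      by (rule sum.swap)
    also have "\<dots> = (\<Sum>i<n. \<Sum>u\<in>Q. \<alpha> x u $ (n - i) * inverse_coeff Q \<alpha> i u v)
        + (\<Sum>u\<in>Q. if x = u then inverse_coeff Q \<alpha> n u v else 0)"
      using \<alpha> q(1) by (simp add: lessThan_Suc_atMost[symmetric]) (intro sum.cong refl, auto)
    also have "\<dots> = of_bool (n = 0 \<and> x = v)"
      using assms(1) q by (simp add: inverse_coeff.simps[of Q \<alpha> n x v])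
    finally show "(\<Sum>u\<in>Q. \<alpha> x u * \<beta> u v) $ n = of_bool (x = v) $ n" by (auto simp: of_bool_def)
  qed
qed

text \<open>The right inverse \<open>\<beta>\<close> has constant term \<open>I\<close> again, so it has a right inverse \<open>\<gamma>\<close> of its own, and
  \<open>\<gamma> = \<alpha> \<beta> \<gamma> = \<alpha>\<close>.\<close>

lemma inverse_exists:
  fixes \<alpha> :: "'q \<Rightarrow> 'q \<Rightarrow> 'k::field fps"
  assumes "finite Q" and \<alpha>: "\<And>x u. x \<in> Q \<Longrightarrow> u \<in> Q \<Longrightarrow> \<alpha> x u $ 0 = of_bool (x = u)"
  shows "\<exists>\<beta>. \<forall>x\<in>Q. \<forall>v\<in>Q. (\<Sum>u\<in>Q. \<alpha> x u * \<beta> u v) = of_bool (x = v) \<and>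
    (\<Sum>u\<in>Q. \<beta> x u * \<alpha> u v) = of_bool (x = v)"
proof -
  obtain \<beta> where \<beta>: "\<And>x u. \<beta> x u $ 0 = of_bool (x = u)"
    "\<And>x v. x \<in> Q \<Longrightarrow> v \<in> Q \<Longrightarrow> (\<Sum>u\<in>Q. \<alpha> x u * \<beta> u v) = of_bool (x = v)"
    using right_inverse_exists[OF assms] by blast
  obtain \<gamma> where \<gamma>: "\<And>x v. x \<in> Q \<Longrightarrow> v \<in> Q \<Longrightarrow> (\<Sum>u\<in>Q. \<beta> x u * \<gamma> u v) = of_bool (x = v)"
    using right_inverse_exists[OF assms(1) \<beta>(1)] by blast
  have eq: "\<gamma> x v = \<alpha> x v" if q: "x \<in> Q" "v \<in> Q" for x v
  proof -
    have "\<gamma> x v = (\<Sum>w\<in>Q. if x = w then \<gamma> w v else 0)" using assms(1) q by simp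
    also have "\<dots> = (\<Sum>w\<in>Q. (\<Sum>u\<in>Q. \<alpha> x u * \<beta> u w) * \<gamma> w v)"
      using \<beta>(2) q by (intro sum.cong refl) auto
    also have "\<dots> = (\<Sum>w\<in>Q. \<Sum>u\<in>Q. \<alpha> x u * (\<beta> u w * \<gamma> w v))"
      by (simp add: sum_distrib_right mult.assoc)
    also have "\<dots> = (\<Sum>u\<in>Q. \<alpha> x u * (\<Sum>w\<in>Q. \<beta> u w * \<gamma> w v))"
      by (subst sum.swap) (simp add: sum_distrib_left)
    also have "\<dots> = (\<Sum>u\<in>Q. if u = v then \<alpha> x u else 0)"
      using \<gamma> q by (intro sum.cong refl) auto
    finally show ?thesis using assms(1) q by simp
  qed
  have "(\<Sum>u\<in>Q. \<beta> x u * \<alpha> u v) = of_bool (x = v)" if q: "x \<in> Q" "v \<in> Q" for x v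
    using \<gamma>[OF q] eq q(2) by (simp cong: sum.cong)
  then show ?thesis using \<beta>(2) by blast
qed

section \<open>Rigidity\<close>

context centreless_class begin

lemma linear_act_left: "linear_on (Q \<times> Q) (Q \<times> Q) c \<Longrightarrow> linear_on ((Q \<times> Q) \<times> Q) ((Q \<times> Q) \<times> Q) (act_left c)"
  unfolding act_left_def by (rule tensor_map_linear) (auto simp: linear_on_def)

lemma linear_act_right: "linear_on (Q \<times> Q) (Q \<times> Q) c \<Longrightarrow> linear_on ((Q \<times> Q) \<times> Q) ((Q \<times> Q) \<times> Q) (act_right c)"
  unfolding act_right_def comp_def
  by (intro linear_on_compose[OF linear_on_compose[OF assoc_right_linear tensor_map_linear] assoc_left_linear])
    (auto simp: linear_on_def)

abbreviation tensor3 :: "(('a \<times> 'a) \<times> 'a \<Rightarrow>\<^sub>0 'r::comm_ring_1) \<Rightarrow> 'a \<Rightarrow> 'a \<Rightarrow> 'a \<Rightarrow> 'r" where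
  "tensor3 w u v z \<equiv> Poly_Mapping.lookup w ((u, v), z)"

lemma tensor3_act_left:
  assumes "w \<in> free_mod ((Q \<times> Q) \<times> Q)" "u \<in> Q" "v \<in> Q" "z \<in> Q"
  shows "tensor3 (act_left c w) u v z = act12 (op_matrix c) (tensor3 w) u v z"
proof -
  have "tensor3 (act_left c w) u v z = (\<Sum>b\<in>(Q \<times> Q) \<times> Q. Poly_Mapping.lookup w b *
      Poly_Mapping.lookup (tensor (c (basis (fst b))) (basis (snd b))) ((u, v), z))"
    unfolding act_left_def tensor_map_def using assms(1)
    by (simp add: lookup_lin_ext[of "(Q \<times> Q) \<times> Q"] case_prod_unfold)
  also have "\<dots> = (\<Sum>((p, q), r)\<in>(Q \<times> Q) \<times> Q. if r = z then tensor3 w p q z * op_matrix c p q u v else 0)"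
    by (intro sum.cong refl) (auto simp: lookup_basis op_matrix_def)
  also have "\<dots> = (\<Sum>(p, q)\<in>Q \<times> Q. \<Sum>r\<in>Q. if r = z then tensor3 w p q z * op_matrix c p q u v else 0)"
    by (simp only: sum.cartesian_product case_prod_unfold fst_conv snd_conv)
  also have "\<dots> = (\<Sum>(p, q)\<in>Q \<times> Q. tensor3 w p q z * op_matrix c p q u v)"
    using assms(4) by simp
  finally show ?thesis by (simp add: act12_def sum.cartesian_product)
qed

lemma tensor3_act_right:
  assumes "w \<in> free_mod ((Q \<times> Q) \<times> Q)" "u \<in> Q" "v \<in> Q" "z \<in> Q"
  shows "tensor3 (act_right c w) u v z = act23 (op_matrix c) (tensor3 w) u v z"
proof -
  have w: "assoc_right w \<in> free_mod (Q \<times> (Q \<times> Q))"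
    using assoc_right_linear assms(1) unfolding linear_on_def by blast
  have "tensor3 (act_right c w) u v z = (\<Sum>b\<in>Q \<times> (Q \<times> Q). Poly_Mapping.lookup (assoc_right w) b *
      Poly_Mapping.lookup (tensor (basis (fst b)) (c (basis (snd b)))) (u, (v, z)))"
    unfolding act_right_def tensor_map_def using w
    by (simp add: lookup_assoc_left lookup_lin_ext[of "Q \<times> (Q \<times> Q)"] case_prod_unfold)
  also have "\<dots> = (\<Sum>(p, (q, r))\<in>Q \<times> (Q \<times> Q). if p = u then tensor3 w u q r * op_matrix c q r v z else 0)"
    by (intro sum.cong refl) (auto simp: lookup_basis op_matrix_def lookup_assoc_right)
  also have "\<dots> = (\<Sum>p\<in>Q. \<Sum>(q, r)\<in>Q \<times> Q. if p = u then tensor3 w u q r * op_matrix c q r v z else 0)"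
    by (simp only: sum.cartesian_product case_prod_unfold fst_conv snd_conv)
  also have "\<dots> = (\<Sum>p\<in>Q. if p = u then \<Sum>(q, r)\<in>Q \<times> Q. tensor3 w u q r * op_matrix c q r v z else 0)"
    by (intro sum.cong refl) auto
  finally show ?thesis using assms(2) by (simp add: act23_def sum.cartesian_product)
qed

text \<open>The passage from operators on the free module with basis \<open>(Q \<times> Q) \<times> Q\<close> to coefficient functions:
  the coefficients of a vector outside this set are 0, whereas those of a tensor \<open>t\<close> may be arbitrary
  there and do not influence either side.\<close>

lemma yang_baxter_op_matrix:
  fixes c :: "('a, 'r::comm_ring_1) tensor_op"
  assumes c: "linear_on (Q \<times> Q) (Q \<times> Q) c"
  shows "(\<forall>w\<in>free_mod ((Q \<times> Q) \<times> Q).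
      act_left c (act_right c (act_left c w)) = act_right c (act_left c (act_right c w)))
    \<longleftrightarrow> yang_baxter (op_matrix c)"
proof -
  let ?m = "op_matrix c" and ?F = "free_mod ((Q \<times> Q) \<times> Q) :: (('a \<times> 'a) \<times> 'a \<Rightarrow>\<^sub>0 'r) set"
  have cl: "act_left c w \<in> ?F" "act_right c w \<in> ?F" if "w \<in> ?F" for w
    using linear_act_left[OF c] linear_act_right[OF c] that by (auto simp: linear_on_def)
  have L: "tensor3 (act_left c (act_right c (act_left c w))) u v z =
      act12 ?m (act23 ?m (act12 ?m t)) u v z"
    and R: "tensor3 (act_right c (act_left c (act_right c w))) u v z =
      act23 ?m (act12 ?m (act23 ?m t)) u v z"
    if w: "w \<in> ?F" and t: "\<And>u v z. u \<in> Q \<Longrightarrow> v \<in> Q \<Longrightarrow> z \<in> Q \<Longrightarrow> tensor3 w u v z = t u v z"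
      and q: "u \<in> Q" "v \<in> Q" "z \<in> Q" for w t u v z
    using q by (simp_all add: tensor3_act_left tensor3_act_right cl w t cong: act12_cong act23_cong)
  show ?thesis
  proof
    assume yb: "\<forall>w\<in>?F. act_left c (act_right c (act_left c w)) = act_right c (act_left c (act_right c w))"
    show "yang_baxter ?m"
      unfolding yang_baxter_def
    proof (intro allI ballI)
      fix t :: "'a \<Rightarrow> 'a \<Rightarrow> 'a \<Rightarrow> 'r" and u v z assume q: "u \<in> Q" "v \<in> Q" "z \<in> Q"
      define w where "w = (\<Sum>b\<in>(Q \<times> Q) \<times> Q. Poly_Mapping.single b (t (fst (fst b)) (snd (fst b)) (snd b)))"
      have lw: "Poly_Mapping.lookup w b = (if b \<in> (Q \<times> Q) \<times> Q then t (fst (fst b)) (snd (fst b)) (snd b) else 0)" for b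
        by (simp add: w_def lookup_sum lookup_single when_def)
      then have w: "w \<in> ?F" by (simp add: free_mod_iff)
      show "act12 ?m (act23 ?m (act12 ?m t)) u v z = act23 ?m (act12 ?m (act23 ?m t)) u v z"
        using L[OF w _ q, of t] R[OF w _ q, of t] yb w by (simp add: lw)
    qed
  next
    assume yb: "yang_baxter ?m"
    show "\<forall>w\<in>?F. act_left c (act_right c (act_left c w)) = act_right c (act_left c (act_right c w))"
    proof (intro ballI free_mod_eqI)
      fix w k assume w: "w \<in> ?F" and k: "k \<in> (Q \<times> Q) \<times> Q"
      show "Poly_Mapping.lookup (act_left c (act_right c (act_left c w))) k =
          Poly_Mapping.lookup (act_right c (act_left c (act_right c w))) k"
        using L[OF w refl] R[OF w refl] yb k unfolding yang_baxter_def by auto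
    qed (intro cl; assumption)+
  qed
qed

lemma rack_op_linear: "linear_on (Q \<times> Q) (Q \<times> Q) (rack_op (conj_op G))"
  unfolding rack_op_def by (rule lin_ext_linear) (auto simp: tensor_basis Q_sub)

text \<open>The inverse of \<open>x \<otimes> y \<mapsto> s (y \<otimes> x \<triangleleft> y)\<close> undoes the conjugation by the first output and divides
  by \<open>s\<close>.\<close>

lemma rescaled_rack_op_yb:
  assumes s: "s * s' = 1"
  shows "yb_operator Q (rescale s (rack_op (conj_op G)) :: ('a, 'r::comm_ring_1) tensor_op)"
proof -
  let ?c = "rescale s (rack_op (conj_op G)) :: ('a, 'r) tensor_op"
  define d :: "('a, 'r) tensor_op" where "d = lin_ext (\<lambda>(u, v). s' \<cdot>\<^sub>f basis (v \<triangleleft> inv u, u))"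
  have c: "linear_on (Q \<times> Q) (Q \<times> Q) ?c"
    unfolding rescale_def by (rule linear_on_scale[OF rack_op_linear])
  have basis: "?c (basis (x, y)) = s \<cdot>\<^sub>f basis (y, x \<triangleleft> y)" for x y
    by (simp add: rescale_def rack_op_def tensor_basis)
  have d: "linear_on (Q \<times> Q) (Q \<times> Q) d"
    unfolding d_def
    by (rule lin_ext_linear) (auto simp: Q_sub intro!: fmod.subspace_scale free_mod_subspace)
  have ss: "s' * s = 1" using s by (simp add: mult.commute)
  have "bij_betw ?c (free_mod (Q \<times> Q)) (free_mod (Q \<times> Q))"
  proof (rule bij_betw_free_modI[OF c d])
    fix b assume "b \<in> Q \<times> Q"
    then obtain x y where b: "b = (x, y)" "x \<in> Q" "y \<in> Q" by auto
    show "d (?c (basis b)) = basis b"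
      using b s by (simp add: basis d_def lin_ext_scale Q_sub)
    have "?c (d (basis b)) = s' \<cdot>\<^sub>f ?c (basis (y \<triangleleft> inv x, x))"
      using b c unfolding d_def linear_on_def by (simp add: Q_sub)
    then show "?c (d (basis b)) = basis b"
      using b ss by (simp add: basis Q_sub)
  qed
  moreover have "yang_baxter (op_matrix ?c)"
    by (rule yang_baxter_rack[of _ s]) (auto simp: op_matrix_def basis lookup_basis rack_matrix_def)
  ultimately show ?thesis
    using c yang_baxter_op_matrix[OF c] by (simp add: yb_operator_def automorphism_on_def)
qed

text \<open>An exact intertwiner \<open>\<alpha>\<close> with factor \<open>s\<close>, read as a map of free modules, is an equivalence between
  \<open>s\<cdot>c\<^sub>Q\<close> and the deformation.\<close>

theorem deformation_equiv_rescaled: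
  fixes c :: "('a, 'k::field_char_0 fps) tensor_op"
  assumes c: "yb_deformation (principal_ideal fps_X) Q (rack_op (conj_op G)) c"
  shows "\<exists>s \<in> (+) 1 ` principal_ideal fps_X.
    yb_equiv (principal_ideal fps_X) Q (rescale s (rack_op (conj_op G))) c"
proof -
  let ?m = "op_matrix c" and ?C = "rack_op (conj_op G) :: ('a, 'k fps) tensor_op"
  let ?F = "free_mod (Q \<times> Q) :: ('a \<times> 'a \<Rightarrow>\<^sub>0 'k fps) set"
  have yb: "yb_operator Q c" and cong: "cong_on (principal_ideal fps_X) (Q \<times> Q) c ?C"
    using c by (auto simp: yb_deformation_def)
  have lin: "linear_on (Q \<times> Q) (Q \<times> Q) c" using yb by (simp add: yb_operator_def automorphism_on_def)
  have "yang_baxter ?m" using yb yang_baxter_op_matrix[OF lin] by (simp add: yb_operator_def)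
  moreover have "deforms ?m"
    unfolding deforms_def
  proof (intro ballI)
    fix x y u v assume q: "x \<in> Q" "y \<in> Q" "u \<in> Q" "v \<in> Q"
    have "c (basis (x, y)) - ?C (basis (x, y)) \<in> ideal_mod (principal_ideal fps_X) (Q \<times> Q)"
      using cong q unfolding cong_on_def by simp
    then have "Poly_Mapping.lookup (c (basis (x, y)) - ?C (basis (x, y))) (u, v) $ 0 = 0"
      unfolding ideal_mod_X by blast
    then show "?m x y u v $ 0 = rack_matrix x y u v"
      by (simp add: op_matrix_def lookup_minus rack_op_def lookup_basis tensor_basis rack_matrix_def of_bool_def)
  qed
  ultimately obtain \<alpha> s where \<alpha>: "near_identity \<alpha>" and s: "s $ 0 = 1"
    and R: "\<And>x y u v. x \<in> Q \<Longrightarrow> y \<in> Q \<Longrightarrow> u \<in> Q \<Longrightarrow> v \<in> Q \<Longrightarrow>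
      twisted ?m \<alpha> x y u v = s * (\<alpha> y u * \<alpha> (x \<triangleleft> y) v)"
    using intertwiner_exists[of ?m] by metis
  obtain \<beta> where \<beta>: "\<And>x v. x \<in> Q \<Longrightarrow> v \<in> Q \<Longrightarrow> (\<Sum>u\<in>Q. \<alpha> x u * \<beta> u v) = of_bool (x = v)"
    "\<And>x v. x \<in> Q \<Longrightarrow> v \<in> Q \<Longrightarrow> (\<Sum>u\<in>Q. \<beta> x u * \<alpha> u v) = of_bool (x = v)"
    using inverse_exists[OF fin_Q, of \<alpha>] \<alpha> unfolding near_identity_def by blast
  let ?a = "matrix_map Q \<alpha>" and ?b = "matrix_map Q \<beta>"
  note la = matrix_map_linear[OF fin_Q, of \<alpha>] and lb = matrix_map_linear[OF fin_Q, of \<beta>]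
  have ab: "?b (?a (basis x)) = basis x" "?a (?b (basis x)) = basis x" if "x \<in> Q" for x
    using that \<beta> by (auto intro!: matrix_map_inverse)
  have aut: "automorphism_on Q ?a"
    using la bij_betw_free_modI[OF la lb ab] by (simp add: automorphism_on_def)
  have "cong_on (principal_ideal fps_X) Q ?a id"
    unfolding cong_on_def ideal_mod_X
  proof (intro ballI conjI allI)
    fix w :: "'a \<Rightarrow>\<^sub>0 'k fps" and p assume w: "w \<in> free_mod Q"
    have aw: "?a w \<in> free_mod Q" using la w by (simp add: linear_on_def)
    then show sub: "?a w - id w \<in> free_mod Q" using w by (simp add: free_mod_iff lookup_minus)
    show "Poly_Mapping.lookup (?a w - id w) p $ 0 = 0"
    proof (cases "p \<in> Q")
      case True
      have "Poly_Mapping.lookup (?a w) p $ 0 = (\<Sum>b\<in>Q. if b = p then Poly_Mapping.lookup w p $ 0 else 0)"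
        unfolding lookup_linear_on[OF la fin_Q w] fps_sum_nth fps_mult_nth_0
        using \<alpha> True by (intro sum.cong refl) (auto simp: lookup_matrix_map_basis near_identity_def)
      then show ?thesis using True by (simp add: lookup_minus)
    qed (use sub in \<open>simp add: free_mod_iff\<close>)
  qed
  moreover have "c w = tensor_map ?a ?a (rescale s ?C (inv_into ?F (tensor_map ?a ?a) w))"
    if w: "w \<in> ?F" for w
  proof -
    let ?A = "tensor_map ?a ?a" and ?B = "tensor_map ?b ?b"
    note lA = tensor_map_linear[OF la la] and lB = tensor_map_linear[OF lb lb]
    have A_basis: "?A (basis (x, y)) = tensor (?a (basis x)) (?a (basis y))"
      and B_basis: "?B (basis (x, y)) = tensor (?b (basis x)) (?b (basis y))" for x y
      by (simp_all add: tensor_map_def)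
    have mem: "?a (basis x) \<in> free_mod Q" "?b (basis x) \<in> free_mod Q" if "x \<in> Q" for x
      using la lb that by (auto simp: linear_on_def)
    have "bij_betw ?A ?F ?F"
      by (rule bij_betw_free_modI[OF lA lB])
        (auto simp: A_basis B_basis tensor_map_tensor[OF la la] tensor_map_tensor[OF lb lb] mem ab tensor_basis)
    then have "w \<in> ?A ` ?F" using w by (simp add: bij_betw_def)
    moreover define w' where "w' = inv_into ?F ?A w"
    ultimately have w': "w' \<in> ?F" "?A w' = w" by (simp_all add: inv_into_into f_inv_into_f)
    have lsC: "linear_on (Q \<times> Q) (Q \<times> Q) (rescale s ?C)"
      unfolding rescale_def by (rule linear_on_scale[OF rack_op_linear])
    have "c (?A w') = ?A (rescale s ?C w')"
    proof (rule linear_on_eqI[OF linear_on_compose[OF lA lin] linear_on_compose[OF lsC lA] _ w'(1)])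
      fix b assume "b \<in> Q \<times> Q"
      then obtain x y where b: "b = (x, y)" "x \<in> Q" "y \<in> Q" by auto
      have "?A (basis b) \<in> ?F" using lA b by (simp add: linear_on_def)
      have C: "?A (rescale s ?C (basis b)) = s \<cdot>\<^sub>f ?A (basis (y, x \<triangleleft> y))"
        using lA b by (simp add: linear_on_def rescale_def rack_op_def tensor_basis Q_sub)
      have F: "c (?A (basis b)) \<in> ?F" "?A (rescale s ?C (basis b)) \<in> ?F"
        using lA lin lsC b by (simp_all add: linear_on_def)
      show "c (?A (basis b)) = ?A (rescale s ?C (basis b))"
      proof (rule free_mod_eqI[OF F])
        fix p assume "p \<in> Q \<times> Q"
        then obtain u v where p: "p = (u, v)" "u \<in> Q" "v \<in> Q" by auto
        have "Poly_Mapping.lookup (c (?A (basis b))) p =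
            (\<Sum>kl\<in>Q \<times> Q. Poly_Mapping.lookup (?A (basis b)) kl * Poly_Mapping.lookup (c (basis kl)) p)"
          by (rule lookup_linear_on[OF lin _ \<open>?A (basis b) \<in> ?F\<close>]) simp
        also have "\<dots> = (\<Sum>(k, l)\<in>Q \<times> Q. \<alpha> x k * \<alpha> y l * ?m k l u v)"
          using b p by (intro sum.cong refl) (auto simp: A_basis lookup_matrix_map_basis op_matrix_def)
        also have "\<dots> = twisted ?m \<alpha> x y u v"
          by (simp add: twisted_def sum.cartesian_product)
        also have "\<dots> = Poly_Mapping.lookup (?A (rescale s ?C (basis b))) p"
          unfolding C using b p by (simp add: R A_basis lookup_matrix_map_basis Q_sub)
        finally show "Poly_Mapping.lookup (c (?A (basis b))) p =
            Poly_Mapping.lookup (?A (rescale s ?C (basis b))) p" .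
      qed
    qed
    then show ?thesis using w'(2) by (simp add: w'_def)
  qed
  moreover have "yb_operator Q (rescale s ?C)"
    by (rule rescaled_rack_op_yb[of s "inverse s"]) (simp add: s inverse_mult_eq_1')
  ultimately have "yb_equiv (principal_ideal fps_X) Q (rescale s ?C) c"
    unfolding yb_equiv_def using yb aut by blast
  moreover have "s \<in> (+) 1 ` principal_ideal fps_X"
    by (rule image_eqI[of _ _ "s - 1"]) (simp_all add: principal_ideal_X s)
  ultimately show ?thesis by blast
qed

end

theorem corollary19:
  fixes G :: "('g, 'b) monoid_scheme" and Q :: "'g set"
    and \<mm> :: "rat fps set" and c\<^sub>Q :: "('g, rat fps) tensor_op"
  assumes "group G" and "finite (carrier G)"
    and "centre G = {\<one>\<^bsub>G\<^esub>}"
    and "conjugacy_class G Q" and "generate G Q = carrier G"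
    and "\<mm> = principal_ideal fps_X"
    and "c\<^sub>Q = rack_op (conj_op G)"
  shows "(\<forall>c. yb_deformation \<mm> Q c\<^sub>Q c \<longrightarrow>
            (\<exists>s \<in> (+) 1 ` \<mm>. yb_equiv \<mm> Q (rescale s c\<^sub>Q) c)) \<and>
         yb_rigid \<mm> Q c\<^sub>Q"
proof -
  interpret centreless_class G Q
    using assms by (simp add: centreless_class_def centreless_class_axioms_def)
  have "rescale 1 c\<^sub>Q = c\<^sub>Q" by (simp add: rescale_def)
  then have "yb_operator Q c\<^sub>Q"
    using rescaled_rack_op_yb[of "1 :: rat fps" 1] assms(7) by simp
  then show ?thesis
    unfolding yb_rigid_def yb_trivial_def assms(6,7) using deformation_equiv_rescaled by blast
qed

end
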